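(* Let $F=\prod_{i=1}^k\mathcal D_i(\mathbb Z^{a_i}\times\mathbb R^{b_i})$ be a free nilspace ($a_i,b_i\in\mathbb Z_{\ge0}$). Let $A=Z\times\mathbb T^s$ be a compact abelian Lie group ($Z$ finite of rank $r$), let $B=\mathbb Z^r\times\mathbb R^s$ be its covering group and $\pi:B\to A$ the covering homomorphism. Then for every $i\in[k]$ and every $\alpha\in\Theta_i(F\times\mathcal D_k(A))$ there exists $\beta\in\Theta_i(F\times\mathcal D_k(B))$ such that, letting $\phi:F\times\mathcal D_k(B)\to F\times\mathcal D_k(A)$ be the morphism $(f,b)\mapsto(f,\pi(b))$, we have $\alpha\circ\phi=\phi\circ\beta$.
   Context: Nilspaces: $\{0,1\}^n$ discrete cube; discrete-cube morphisms have coordinate functions $v\mapsto0,1,v_j,1-v_j$; faces of codimension $i$ fix $i$ coordinates. A nilspace is a set $X$ with sets $C^n(X)\subseteq X^{\{0,1\}^n}$ of $n$-cubes closed under composition with discrete-cube morphisms, $C^1(X)=X^{\{0,1\}}$, and every $n$-corner extending to a cube; morphisms send cubes to cubes; products have coordinatewise cubes. For abelian $G$ and $k\ge1$, $\mathcal D_k(G)$ is $G$ with $n$-cubes the maps $c$ with $\sum_{v\in\{0,1\}^{k+1}}(-1)^{|v|}c(\phi(v))=0$ for every discrete-cube morphism $\phi:\{0,1\}^{k+1}\to\{0,1\}^n$. A translation of height $i$ is a map $\alpha:X\to X$ such that for all $n$, $c\in C^n(X)$ and faces $F'$ of codimension $i$, the map equal to $\alpha\circ c$ on $F'$ and $c$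 off $F'$ is a cube. For the topological (locally compact) nilspaces here (product topologies with the Euclidean, discrete and torus topologies), $\Theta_i(\cdot)$ denotes the group of continuous translations of height $i$. The covering homomorphism $\pi:\mathbb Z^r\times\mathbb R^s\to Z\times\mathbb T^s$, for $Z\cong\prod_{j=1}^r\mathbb Z/n_j\mathbb Z$ with $r$ minimal, reduces each $\mathbb Z$-coordinate mod $n_j$ and each $\mathbb R$-coordinate mod $1$. *)

theory Defs
  imports "HOL-Analysis.Analysis" "HOL-Algebra.FiniteProduct" "HOL-Algebra.Product_Groups"
begin

text \<open>Points of \<open>{0,1}\<^sup>n\<close> are 0/1-valued functions on \<open>{..<n}\<close>, extensional in the sense of
  \<^term>\<open>PiE\<close>. All maps between sets of points below are extensional in the same sense, so that
  equality of functions is equality of maps.\<close>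

definition dcube :: "nat \<Rightarrow> (nat \<Rightarrow> nat) set" where
  "dcube n = ({..<n} \<rightarrow>\<^sub>E {0, 1})"

definition dcube_weight :: "nat \<Rightarrow> (nat \<Rightarrow> nat) \<Rightarrow> nat" where
  "dcube_weight n v = (\<Sum>j<n. v j)"

definition dcube_morphism :: "nat \<Rightarrow> nat \<Rightarrow> ((nat \<Rightarrow> nat) \<Rightarrow> (nat \<Rightarrow> nat)) set" where
  "dcube_morphism m n =
    {\<phi> \<in> dcube m \<rightarrow>\<^sub>E dcube n. \<forall>j<n.
        (\<forall>v\<in>dcube m. \<phi> v j = 0) \<or>
        (\<forall>v\<in>dcube m. \<phi> v j = 1) \<or>
        (\<exists>i<m. \<forall>v\<in>dcube m. \<phi> v j = v i) \<or>
        (\<exists>i<m. \<forall>v\<in>dcube m. \<phi> v j = 1 - v i)}"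

definition dcube_faces :: "nat \<Rightarrow> nat \<Rightarrow> (nat \<Rightarrow> nat) set set" where
  "dcube_faces n i =
    {{v \<in> dcube n. \<forall>j\<in>J. v j = w j} | J w. J \<subseteq> {..<n} \<and> card J = i \<and> w \<in> J \<rightarrow> {0, 1}}"

text \<open>The underlying set of a cube space is the \<^term>\<open>topspace\<close> of its topology.\<close>

record 'a cubespace =
  ctop :: "'a topology"
  cubes :: "nat \<Rightarrow> ((nat \<Rightarrow> nat) \<Rightarrow> 'a) set"

abbreviation points :: "'a cubespace \<Rightarrow> 'a set" where
  "points X \<equiv> topspace (ctop X)"

definition translation :: "nat \<Rightarrow> 'a cubespace \<Rightarrow> ('a \<Rightarrow> 'a) \<Rightarrow> bool" where
  "translation i X \<alpha> \<longleftrightarrow>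
    \<alpha> \<in> points X \<rightarrow>\<^sub>E points X \<and>
    (\<forall>n. \<forall>c\<in>cubes X n. \<forall>F'\<in>dcube_faces n i.
        (\<lambda>v\<in>dcube n. if v \<in> F' then \<alpha> (c v) else c v) \<in> cubes X n)"

definition cont_translations :: "nat \<Rightarrow> 'a cubespace \<Rightarrow> ('a \<Rightarrow> 'a) set"  (\<open>\<Theta>\<close>) where
  "\<Theta> i X = {\<alpha>. translation i X \<alpha> \<and> continuous_map (ctop X) (ctop X) \<alpha>}"

definition prod_cubespace :: "'a cubespace \<Rightarrow> 'b cubespace \<Rightarrow> ('a \<times> 'b) cubespace"
    (infixr \<open>\<times>\<^sub>C\<close> 80) where
  "X \<times>\<^sub>C Y = \<lparr>ctop = prod_topology (ctop X) (ctop Y),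
     cubes = (\<lambda>n. {c \<in> dcube n \<rightarrow>\<^sub>E points X \<times> points Y.
        (\<lambda>v\<in>dcube n. fst (c v)) \<in> cubes X n \<and> (\<lambda>v\<in>dcube n. snd (c v)) \<in> cubes Y n})\<rparr>"

definition product_cubespace :: "'i set \<Rightarrow> ('i \<Rightarrow> 'a cubespace) \<Rightarrow> ('i \<Rightarrow> 'a) cubespace" where
  "product_cubespace I X = \<lparr>ctop = product_topology (\<lambda>i. ctop (X i)) I,
     cubes = (\<lambda>n. {c \<in> dcube n \<rightarrow>\<^sub>E (\<Pi>\<^sub>E i\<in>I. points (X i)).
        \<forall>i\<in>I. (\<lambda>v\<in>dcube n. c v i) \<in> cubes (X i) n})\<rparr>"

text \<open>\<open>\<D> k G T\<close> is the degree-\<open>k\<close> nilspace on the abelian group \<open>G\<close>, where \<open>T\<close> is a topology on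
  the carrier of \<open>G\<close>. The group is written multiplicatively, so the alternating sum
  becomes a product of powers with exponent \<open>\<plusminus>1\<close>.\<close>

definition Dnil :: "nat \<Rightarrow> 'a monoid \<Rightarrow> 'a topology \<Rightarrow> 'a cubespace"  (\<open>\<D>\<close>) where
  "\<D> k G T = \<lparr>ctop = T,
     cubes = (\<lambda>n. {c \<in> dcube n \<rightarrow>\<^sub>E carrier G.
        \<forall>\<phi>\<in>dcube_morphism (k + 1) n.
          (\<Otimes>\<^bsub>G\<^esub>v\<in>dcube (k + 1). c (\<phi> v) [^]\<^bsub>G\<^esub> ((-1) ^ dcube_weight (k + 1) v :: int)) = \<one>\<^bsub>G\<^esub>})\<rparr>"

definition real_group :: "real monoid" where
  "real_group = \<lparr>carrier = UNIV, monoid.mult = (+), one = 0\<rparr>"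

text \<open>\<open>\<real>/\<int>\<close> on the representatives \<open>[0,1)\<close>, like \<^const>\<open>integer_mod_group\<close>. Reduction mod 1 is
  \<^const>\<open>frac\<close>, and the topology is the quotient topology along it, not the subspace topology
  of \<open>[0,1)\<close>.\<close>

definition circle_group :: "real monoid" where
  "circle_group = \<lparr>carrier = {0..<1}, monoid.mult = (\<lambda>x y. frac (x + y)), one = 0\<rparr>"

definition circle_topology :: "real topology" where
  "circle_topology = topology (\<lambda>U. U \<subseteq> {0..<1} \<and> open (frac -` U))"

lemma openin_circle_topology:
  "openin circle_topology U \<longleftrightarrow> U \<subseteq> {0..<1} \<and> open (frac -` U)"
proof -
  have "istopology (\<lambda>U. U \<subseteq> {0..<1} \<and> open ((frac :: real \<Rightarrow> real) -` U))"
    unfolding istopology_def by (auto simp: vimage_Union)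
  then show ?thesis
    by (simp add: circle_topology_def)
qed

lemma topspace_circle_topology [simp]: "topspace circle_topology = {0..<1}"
proof -
  have "(frac :: real \<Rightarrow> real) -` {0..<1} = UNIV"
    by (auto simp: frac_lt_1)
  then have "openin circle_topology {0..<1}"
    by (simp add: openin_circle_topology)
  then show ?thesis
    by (metis openin_circle_topology openin_subset openin_topspace subset_antisym)
qed

lemma quotient_map_frac: "quotient_map euclideanreal circle_topology frac"
proof -
  have "range (frac :: real \<Rightarrow> real) = {0..<1}"
    by (auto simp: frac_lt_1 image_iff) (metis frac_eq)
  then show ?thesis
    by (auto simp: quotient_map_def openin_circle_topology vimage_def)
qed

lemma frac_frac_add: "frac (frac u + w) = frac (u + w)" for u w :: real
proof -
  have "frac u + w = (u + w) - of_int \<lfloor>u\<rfloor>"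
    by (simp add: frac_def)
  then show ?thesis
    by (simp only: frac_def floor_diff_of_int)
qed

lemma comm_group_circle_group: "comm_group circle_group"
proof (rule comm_groupI)
  fix x y z assume "x \<in> carrier circle_group" "y \<in> carrier circle_group" "z \<in> carrier circle_group"
  show "x \<otimes>\<^bsub>circle_group\<^esub> y \<otimes>\<^bsub>circle_group\<^esub> z
      = x \<otimes>\<^bsub>circle_group\<^esub> (y \<otimes>\<^bsub>circle_group\<^esub> z)"
    using frac_frac_add[of "x + y" z] frac_frac_add[of "y + z" x]
    by (simp add: circle_group_def ac_simps)
next
  fix x assume "x \<in> carrier circle_group"
  show "\<exists>y\<in>carrier circle_group. y \<otimes>\<^bsub>circle_group\<^esub> x = \<one>\<^bsub>circle_group\<^esub>"
    using frac_frac_add[of "- x" x]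
    by (intro bexI[of _ "frac (- x)"]) (simp_all add: circle_group_def frac_lt_1)
qed (auto simp: circle_group_def frac_lt_1 frac_eq add.commute)

definition ZR_group :: "nat \<Rightarrow> nat \<Rightarrow> ((nat \<Rightarrow> int) \<times> (nat \<Rightarrow> real)) monoid" where
  "ZR_group a b =
    product_group {..<a} (\<lambda>_. integer_group) \<times>\<times> product_group {..<b} (\<lambda>_. real_group)"

definition ZR_topology :: "nat \<Rightarrow> nat \<Rightarrow> ((nat \<Rightarrow> int) \<times> (nat \<Rightarrow> real)) topology" where
  "ZR_topology a b =
    prod_topology (product_topology (\<lambda>_. discrete_topology UNIV) {..<a})
                  (product_topology (\<lambda>_. euclideanreal) {..<b})"

lemma topspace_ZR_topology: "topspace (ZR_topology a b) = carrier (ZR_group a b)"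
  by (simp add: ZR_topology_def ZR_group_def integer_group_def real_group_def)

definition ZT_group :: "'z monoid \<Rightarrow> nat \<Rightarrow> ('z \<times> (nat \<Rightarrow> real)) monoid" where
  "ZT_group Z s = Z \<times>\<times> product_group {..<s} (\<lambda>_. circle_group)"

definition ZT_topology :: "'z monoid \<Rightarrow> nat \<Rightarrow> ('z \<times> (nat \<Rightarrow> real)) topology" where
  "ZT_topology Z s =
    prod_topology (discrete_topology (carrier Z)) (product_topology (\<lambda>_. circle_topology) {..<s})"

lemma topspace_ZT_topology: "topspace (ZT_topology Z s) = carrier (ZT_group Z s)"
  by (simp add: ZT_topology_def ZT_group_def circle_group_def)

definition free_nilspace ::
    "nat \<Rightarrow> (nat \<Rightarrow> nat) \<Rightarrow> (nat \<Rightarrow> nat) \<Rightarrow> (nat \<Rightarrow> (nat \<Rightarrow> int) \<times> (nat \<Rightarrow> real)) cubespace" where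
  "free_nilspace k a b =
    product_cubespace {1..k} (\<lambda>i. \<D> i (ZR_group (a i) (b i)) (ZR_topology (a i) (b i)))"

abbreviation cyclic_product :: "nat \<Rightarrow> (nat \<Rightarrow> nat) \<Rightarrow> (nat \<Rightarrow> int) monoid" where
  "cyclic_product r n \<equiv> product_group {..<r} (\<lambda>j. integer_mod_group (n j))"

text \<open>The rank of a finite abelian group is the least number of factors in a decomposition into
  finite cyclic groups; \<open>n j > 0\<close> is needed because \<open>integer_mod_group 0\<close> is \<open>\<int>\<close>.\<close>

definition finite_rank :: "'z monoid \<Rightarrow> nat" where
  "finite_rank Z = (LEAST r. \<exists>n. (\<forall>j<r. 0 < n j) \<and> cyclic_product r n \<cong> Z)"

text \<open>The isomorphism \<open>h\<close> from \<open>cyclic_product r n\<close> to \<open>Z\<close> is a parameter.\<close>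

definition covering_hom ::
    "nat \<Rightarrow> (nat \<Rightarrow> nat) \<Rightarrow> ((nat \<Rightarrow> int) \<Rightarrow> 'z) \<Rightarrow> nat
      \<Rightarrow> (nat \<Rightarrow> int) \<times> (nat \<Rightarrow> real) \<Rightarrow> 'z \<times> (nat \<Rightarrow> real)" where
  "covering_hom r n h s =
    (\<lambda>(z, x). (h (\<lambda>j\<in>{..<r}. z j mod int (n j)), \<lambda>j\<in>{..<s}. frac (x j)))"

end

theory Submission
  imports Defs
begin

text \<open>
  Applying \<open>\<alpha>\<close> to cubes of dimension \<open>k + 1\<close> shows \<open>\<alpha> (f, y) = (\<alpha>\<^sub>F f, y + w f)\<close>, where \<open>w\<close> is a
  continuous morphism from \<open>F\<close> to the degree \<open>k - i\<close> structure on \<open>Z \<times> \<real>\<^sup>s / \<int>\<^sup>s\<close>. So it suffices to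
  lift \<open>w\<close> to a continuous morphism into \<open>\<int>\<^sup>r \<times> \<real>\<^sup>s\<close>, one coordinate at a time. Writing
  \<open>\<int> / n\<close> as \<open>(1/n)\<int> / \<int>\<close> inside \<open>\<real> / \<int>\<close>, every coordinate becomes a map to \<open>\<real> / \<int>\<close>, which has
  to be lifted to \<open>\<real>\<close>; a lift of a \<open>(1/n)\<int> / \<int>\<close>-valued map is automatically \<open>(1/n)\<int>\<close>-valued.

  On the integer coordinates of \<open>F\<close> the lift is built by discrete integration: the difference of \<open>w\<close>
  along a coordinate of weight \<open>j\<close> has degree smaller by \<open>j\<close>, so it lifts by induction. Along the real
  coordinates the lift is the path lift along \<open>t \<mapsto> t \<cdot> x\<close>. The result is a morphism: the alternating
  sums over a cube are integers that depend continuously on the scaling parameter \<open>t\<close>, and they vanish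
  for \<open>t = 0\<close>.
\<close>

section \<open>Functions of bounded degree on discrete cubes\<close>

text \<open>The obstacle is that a lift chosen point by point need not be a morphism: its
  alternating sums are integers, but they have to be 0. Along the real coordinates connectedness
  excludes the other integers. Between lattice points continuity imposes nothing, so there the lift
  must come from a construction that respects degree.

  All degree arguments rest on one normal form: a function on the cube is a combination of
  square-free monomials in the vertex coordinates, and it has degree \<open>d\<close> modulo a
  subgroup \<open>K\<close> of the reals exactly when every monomial of size above \<open>d\<close>
  has its coefficient in \<open>K\<close>. Two consequences carry the proof. In dimension
  \<open>d + 1\<close> the coefficient of the full monomial lies in \<open>K\<close>; this forces
  the shape of \<alpha>. And if a function times \<open>q\<close> fresh coordinates has degree
  \<open>d + q\<close>, then the function has degree \<open>d\<close>; this converts a change on a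
  face of codimension \<open>q\<close> into a map of degree lower by \<open>q\<close>, both for
  \<alpha> and for differences along lattice coordinates.\<close>

lemma finite_dcube: "finite (dcube n)"
  by (simp add: dcube_def finite_PiE)

lemma dcube_value: "v \<in> dcube n \<Longrightarrow> j < n \<Longrightarrow> v j \<in> {0, 1}"
  by (auto simp: dcube_def PiE_iff)

lemma dcube_flip: "v \<in> dcube n \<Longrightarrow> j < n \<Longrightarrow> v(j := 1 - v j) \<in> dcube n"
  by (auto simp: dcube_def PiE_iff extensional_def)

lemma dcube_restrict: "v \<in> dcube n \<Longrightarrow> m \<le> n \<Longrightarrow> restrict v {..<m} \<in> dcube m"
  by (auto simp: dcube_def PiE_iff)

lemma dcube_morphism_app: "\<phi> \<in> dcube_morphism m n \<Longrightarrow> v \<in> dcube m \<Longrightarrow> \<phi> v \<in> dcube n"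
  by (auto simp: dcube_morphism_def)

text \<open>The subgroup stays a parameter so that each degree argument serves both targets: exact
  statements take \<open>{0}\<close>, statements modulo 1 take \<open>\<int>\<close>.\<close>

definition add_subgroup :: "real set \<Rightarrow> bool" where
  "add_subgroup K \<longleftrightarrow> 0 \<in> K \<and> (\<forall>x\<in>K. \<forall>y\<in>K. x - y \<in> K)"

lemma add_subgroup_zero [simp]: "add_subgroup {0}"
  and add_subgroup_Ints [simp]: "add_subgroup \<int>"
  by (auto simp: add_subgroup_def)

context
  fixes K assumes K: "add_subgroup K"
begin

lemma subgroup_0: "0 \<in> K"
  using K by (auto simp: add_subgroup_def)

lemma subgroup_diff: "x \<in> K \<Longrightarrow> y \<in> K \<Longrightarrow> x - y \<in> K"
  using K by (auto simp: add_subgroup_def)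

lemma subgroup_minus: "x \<in> K \<Longrightarrow> - x \<in> K"
  using subgroup_diff[OF subgroup_0] by simp

lemma subgroup_minus_iff: "- x \<in> K \<longleftrightarrow> x \<in> K"
  using subgroup_minus by force

lemma subgroup_add: "x \<in> K \<Longrightarrow> y \<in> K \<Longrightarrow> x + y \<in> K"
  using subgroup_diff[OF _ subgroup_minus, of x y] by simp

lemma subgroup_cong: "x - y \<in> K \<Longrightarrow> x \<in> K \<longleftrightarrow> y \<in> K"
  using subgroup_add[of "x - y" y] subgroup_diff[of x "x - y"] by (simp, blast)

lemma subgroup_sum: "(\<And>x. x \<in> S \<Longrightarrow> f x \<in> K) \<Longrightarrow> sum f S \<in> K"
  by (induction S rule: infinite_finite_induct) (auto simp: subgroup_0 subgroup_add)

lemma subgroup_nat_mult: "x \<in> K \<Longrightarrow> of_nat m * x \<in> K"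
  by (induction m) (auto simp: subgroup_0 subgroup_add algebra_simps)

lemma subgroup_int_mult: "z \<in> \<int> \<Longrightarrow> x \<in> K \<Longrightarrow> z * x \<in> K"
  using subgroup_nat_mult subgroup_minus
  by (elim Ints_cases, rename_tac m, case_tac m rule: int_cases2) fastforce+

end

section \<open>Signed sums over the vertices of a cube\<close>

definition altsum :: "nat \<Rightarrow> ((nat \<Rightarrow> nat) \<Rightarrow> real) \<Rightarrow> real" where
  "altsum p g = (\<Sum>v\<in>dcube p. (-1) ^ dcube_weight p v * g v)"

lemma altsum_cong: "(\<And>v. v \<in> dcube p \<Longrightarrow> g v = g' v) \<Longrightarrow> altsum p g = altsum p g'"
  by (simp add: altsum_def)

lemma altsum_add: "altsum p (\<lambda>v. g v + g' v) = altsum p g + altsum p g'"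
  by (simp add: altsum_def distrib_left sum.distrib)

lemma altsum_diff: "altsum p (\<lambda>v. g v - g' v) = altsum p g - altsum p g'"
  by (simp add: altsum_def right_diff_distrib sum_subtractf)

lemma altsum_cmult: "altsum p (\<lambda>v. x * g v) = x * altsum p g"
  by (simp add: altsum_def sum_distrib_left mult_ac)

lemma altsum_sum: "altsum p (\<lambda>v. \<Sum>s\<in>S. g s v) = (\<Sum>s\<in>S. altsum p (g s))"
  unfolding altsum_def sum_distrib_left by (rule sum.swap)

lemma altsum_in:
  assumes "add_subgroup K" "\<And>v. v \<in> dcube p \<Longrightarrow> g v \<in> K"
  shows "altsum p g \<in> K"
  unfolding altsum_def by (auto intro!: subgroup_sum subgroup_int_mult assms)

text \<open>Flipping coordinate \<open>j\<close> is an involution of the cube that reverses every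
  sign and keeps every value, so the sum equals its own negative.\<close>

lemma altsum_eq_0:
  assumes j: "j < p" and g: "\<And>v. v \<in> dcube p \<Longrightarrow> g (v(j := 1 - v j)) = g v"
  shows "altsum p g = 0"
proof -
  define f where "f = (\<lambda>v::nat \<Rightarrow> nat. v(j := 1 - v j))"
  have w: "(-1::real) ^ dcube_weight p (f v) = - ((-1) ^ dcube_weight p v)" if "v \<in> dcube p" for v
  proof -
    have "dcube_weight p v = v j + (\<Sum>l\<in>{..<p} - {j}. v l)"
      "dcube_weight p (f v) = (1 - v j) + (\<Sum>l\<in>{..<p} - {j}. v l)"
      unfolding dcube_weight_def using j by (auto simp: sum.remove[of _ j] f_def)
    then show ?thesis
      using dcube_value[OF that j] by (auto simp: power_add)
  qed
  have "altsum p g = (\<Sum>v\<in>dcube p. (-1) ^ dcube_weight p (f v) * g (f v))"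
    unfolding altsum_def
  proof (rule sum.reindex_bij_witness[of _ f f])
    fix v assume v: "v \<in> dcube p"
    show "f (f v) = v"
      using dcube_value[OF v j] by (auto simp: f_def)
    then show "(- 1) ^ dcube_weight p (f (f v)) * g (f (f v)) = (- 1) ^ dcube_weight p v * g v"
      by simp
    show "f v \<in> dcube p"
      unfolding f_def using v j by (rule dcube_flip)
    then show "f v \<in> dcube p" .
    show "f (f v) = v" using \<open>f (f v) = v\<close> .
  qed
  also have "\<dots> = - altsum p g"
    unfolding altsum_def sum_negf[symmetric]
    by (intro sum.cong) (simp_all add: w, simp add: f_def g del: One_nat_def)
  finally show ?thesis by simp
qed

section \<open>Square-free monomials in the vertex coordinates\<close>

definition vmono :: "nat set \<Rightarrow> (nat \<Rightarrow> nat) \<Rightarrow> real" where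
  "vmono S v = (\<Prod>l\<in>S. real (v l))"

lemma vmono_Ints [simp]: "vmono S v \<in> \<int>"
  unfolding vmono_def by (rule Ints_prod) auto

lemma vmono_empty [simp]: "vmono {} v = 1"
  by (simp add: vmono_def)

lemma vmono_restrict: "S \<subseteq> T \<Longrightarrow> vmono S (restrict v T) = vmono S v"
  unfolding vmono_def by (intro prod.cong) auto

text \<open>On 0/1 vectors a monomial is the indicator of a face. Hence a product of monomials
  belongs to the union of the index sets, even if these overlap.\<close>

lemma vmono_eq:
  assumes "v \<in> dcube n" "S \<subseteq> {..<n}"
  shows "vmono S v = (if \<forall>l\<in>S. v l = 1 then 1 else 0)"
proof (cases "\<forall>l\<in>S. v l = 1")
  case False
  then obtain l where "l \<in> S" "v l = 0"
    using assms(2) dcube_value[OF assms(1)] by (metis False insertE lessThan_iff singletonD subsetD)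
  moreover have "finite S"
    using assms(2) finite_subset by blast
  ultimately show ?thesis
    using False by (auto simp: vmono_def)
qed (simp add: vmono_def)

lemma vmono_mult:
  assumes "v \<in> dcube n" "S \<subseteq> {..<n}" "T \<subseteq> {..<n}"
  shows "vmono S v * vmono T v = vmono (S \<union> T) v"
  using assms by (auto simp: vmono_eq[OF assms(1)])

text \<open>Each coordinate of a cube morphism depends on at most one input coordinate. By
  pigeonhole a monomial in fewer than \<open>p\<close> coordinates ignores some input coordinate,
  and the signed sum cancels along it.\<close>

lemma altsum_vmono_eq_0:
  assumes \<phi>: "\<phi> \<in> dcube_morphism p n" and S: "S \<subseteq> {..<n}" "card S < p"
  shows "altsum p (\<lambda>v. vmono S (\<phi> v)) = 0"
proof -
  \<comment> \<open>\<open>t\<close> is the only input that output \<open>l\<close> can react to;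
    for a constant output any \<open>t\<close> serves.\<close>
  have "\<exists>t. \<forall>j<p. j \<noteq> t \<longrightarrow> (\<forall>v\<in>dcube p. \<phi> (v(j := 1 - v j)) l = \<phi> v l)" if "l < n" for l
  proof -
    have "(\<forall>v\<in>dcube p. \<phi> v l = 0) \<or> (\<forall>v\<in>dcube p. \<phi> v l = 1) \<or>
        (\<exists>t<p. \<forall>v\<in>dcube p. \<phi> v l = v t) \<or> (\<exists>t<p. \<forall>v\<in>dcube p. \<phi> v l = 1 - v t)"
      using \<phi> that by (simp add: dcube_morphism_def)
    then consider b where "\<forall>v\<in>dcube p. \<phi> v l = b" | t where "t < p" "\<forall>v\<in>dcube p. \<phi> v l = v t"
      | t where "t < p" "\<forall>v\<in>dcube p. \<phi> v l = 1 - v t"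
      by metis
    then show ?thesis
    proof cases
      case 1
      then have "\<forall>j<p. \<forall>v\<in>dcube p. \<phi> (v(j := 1 - v j)) l = \<phi> v l"
        using dcube_flip by metis
      then show ?thesis by blast
    next
      case 2
      then have "\<forall>j<p. j \<noteq> t \<longrightarrow> (\<forall>v\<in>dcube p. \<phi> (v(j := 1 - v j)) l = \<phi> v l)"
        using dcube_flip by (metis fun_upd_other)
      then show ?thesis by blast
    next
      case 3
      then have "\<forall>j<p. j \<noteq> t \<longrightarrow> (\<forall>v\<in>dcube p. \<phi> (v(j := 1 - v j)) l = \<phi> v l)"
        using dcube_flip by (metis fun_upd_other)
      then show ?thesis by blast
    qed
  qed
  then obtain t where t: "\<And>l j v. l < n \<Longrightarrow> j < p \<Longrightarrow> j \<noteq> t l \<Longrightarrow> v \<in> dcube p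
      \<Longrightarrow> \<phi> (v(j := 1 - v j)) l = \<phi> v l"
    by metis
  have "finite S"
    using S(1) finite_subset by blast
  then have "card (t ` S) < card {..<p}"
    using S(2) card_image_le[of S t] by simp
  then have "\<not> {..<p} \<subseteq> t ` S"
    using \<open>finite S\<close> by (meson card_mono finite_imageI not_le)
  then obtain j where j: "j < p" "j \<notin> t ` S"
    by auto
  show ?thesis
  proof (rule altsum_eq_0[OF j(1)])
    fix v assume v: "v \<in> dcube p"
    have "\<phi> (v(j := 1 - v j)) l = \<phi> v l" if "l \<in> S" for l
      using that S(1) j by (intro t v) auto
    then show "vmono S (\<phi> (v(j := 1 - v j))) = vmono S (\<phi> v)"
      by (simp add: vmono_def)
  qed
qed

text \<open>\<open>K = {0}\<close> gives the cubes of the degree-\<open>d\<close> nilspace on \<open>\<real>\<close>; \<open>K = \<int>\<close> those on \<open>\<real> / \<int>\<close>, with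
  real representatives.\<close>

definition deg_le :: "real set \<Rightarrow> nat \<Rightarrow> nat \<Rightarrow> ((nat \<Rightarrow> nat) \<Rightarrow> real) \<Rightarrow> bool" where
  "deg_le K d n g \<longleftrightarrow> (\<forall>\<phi>\<in>dcube_morphism (d + 1) n. altsum (d + 1) (\<lambda>v. g (\<phi> v)) \<in> K)"

lemma deg_le_cong:
  assumes "\<And>v. v \<in> dcube n \<Longrightarrow> g v = g' v"
  shows "deg_le K d n g \<longleftrightarrow> deg_le K d n g'"
proof -
  have "altsum (d + 1) (\<lambda>v. g (\<phi> v)) = altsum (d + 1) (\<lambda>v. g' (\<phi> v))"
    if "\<phi> \<in> dcube_morphism (d + 1) n" for \<phi>
    by (rule altsum_cong) (auto intro!: assms dcube_morphism_app[OF that])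
  then show ?thesis by (simp add: deg_le_def)
qed

lemma deg_le_eqI:
  "deg_le K d n g' \<Longrightarrow> (\<And>v. v \<in> dcube n \<Longrightarrow> g v = g' v) \<Longrightarrow> deg_le K d n g"
  using deg_le_cong by blast

lemma deg_le_add:
  "add_subgroup K \<Longrightarrow> deg_le K d n g \<Longrightarrow> deg_le K d n g' \<Longrightarrow> deg_le K d n (\<lambda>v. g v + g' v)"
  by (simp add: deg_le_def altsum_add subgroup_add)

lemma deg_le_diff:
  "add_subgroup K \<Longrightarrow> deg_le K d n g \<Longrightarrow> deg_le K d n g' \<Longrightarrow> deg_le K d n (\<lambda>v. g v - g' v)"
  by (simp add: deg_le_def altsum_diff subgroup_diff)

lemma deg_le_sum:
  "add_subgroup K \<Longrightarrow> (\<And>s. s \<in> S \<Longrightarrow> deg_le K d n (g s)) \<Longrightarrow> deg_le K d n (\<lambda>v. \<Sum>s\<in>S. g s v)"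
  by (simp add: deg_le_def altsum_sum subgroup_sum)

lemma deg_le_in:
  "add_subgroup K \<Longrightarrow> (\<And>v. v \<in> dcube n \<Longrightarrow> g v \<in> K) \<Longrightarrow> deg_le K d n g"
  by (auto simp: deg_le_def intro!: altsum_in dcube_morphism_app)

lemma deg_le_congruent:
  assumes "add_subgroup K" "\<And>v. v \<in> dcube n \<Longrightarrow> g v - g' v \<in> K" "deg_le K d n g'"
  shows "deg_le K d n g"
  using deg_le_add[OF assms(1) deg_le_in[of K n "\<lambda>v. g v - g' v", OF assms(1,2)] assms(3)] by simp

lemma deg_le_vmono:
  assumes "add_subgroup K" "S \<subseteq> {..<n}" "card S \<le> d"
  shows "deg_le K d n (\<lambda>v. x * vmono S v)"
  using assms by (simp add: deg_le_def altsum_cmult altsum_vmono_eq_0 subgroup_0)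

lemma deg_le_const:
  assumes "add_subgroup K" shows "deg_le K d n (\<lambda>v. x)"
  using deg_le_vmono[OF assms, of "{}"] by simp

lemma deg_le_vmono_in:
  assumes "add_subgroup K" "x \<in> K"
  shows "deg_le K d n (\<lambda>v. x * vmono S v)"
  by (rule deg_le_in[OF assms(1)]) (metis assms subgroup_int_mult vmono_Ints mult.commute)

section \<open>Vertices as subsets, and Moebius inversion\<close>

definition vind :: "nat \<Rightarrow> nat set \<Rightarrow> nat \<Rightarrow> nat" where
  "vind n T = (\<lambda>l\<in>{..<n}. if l \<in> T then 1 else 0)"

lemma vind_dcube [simp]: "vind n T \<in> dcube n"
  by (auto simp: vind_def dcube_def)

lemma vmono_vind:
  assumes "S \<subseteq> {..<n}" shows "vmono S (vind n T) = (if S \<subseteq> T then 1 else 0)"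
  using assms unfolding vmono_eq[OF vind_dcube assms] by (fastforce simp: vind_def)

text \<open>Lets a signed sum over the subsets of any \<open>p\<close>-element index set be read as
  an \<open>altsum\<close>, with cardinality in the role of weight.\<close>

lemma bij_betw_dcube_Pow:
  assumes e: "bij_betw e S {..<p}" and S: "finite S"
  shows "bij_betw (\<lambda>v. {l \<in> S. v (e l) = 1}) (dcube p) (Pow S)"
    and "v \<in> dcube p \<Longrightarrow> dcube_weight p v = card {l \<in> S. v (e l) = 1}"
proof -
  show "bij_betw (\<lambda>v. {l \<in> S. v (e l) = 1}) (dcube p) (Pow S)"
  proof (rule bij_betw_byWitness[where f' = "\<lambda>T. vind p (e ` T)"])
    show "\<forall>v\<in>dcube p. vind p (e ` {l \<in> S. v (e l) = 1}) = v"
    proof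
      fix v assume v: "v \<in> dcube p"
      show "vind p (e ` {l \<in> S. v (e l) = 1}) = v"
      proof
        fix t show "vind p (e ` {l \<in> S. v (e l) = 1}) t = v t"
        proof (cases "t < p")
          case True
          then obtain l where "l \<in> S" "e l = t"
            using e True by (metis bij_betw_imp_surj_on imageE lessThan_iff)
          then show ?thesis
            using dcube_value[OF v True] True by (auto simp: vind_def)
        next
          case False
          then show ?thesis using v by (auto simp: vind_def dcube_def PiE_iff extensional_def)
        qed
      qed
    qed
    show "\<forall>T\<in>Pow S. {l \<in> S. vind p (e ` T) (e l) = 1} = T"
    proof
      fix T assume "T \<in> Pow S"
      moreover have "e l \<in> e ` T \<longleftrightarrow> l \<in> T" if "l \<in> S" for l
        using e that \<open>T \<in> Pow S\<close> by (metis Pow_iff bij_betw_imp_inj_on inj_on_image_mem_iff)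
      moreover have "e l < p" if "l \<in> S" for l
        using e that by (auto simp: bij_betw_def)
      ultimately show "{l \<in> S. vind p (e ` T) (e l) = 1} = T"
        by (auto simp: vind_def split: if_splits)
    qed
  qed auto
  assume v: "v \<in> dcube p"
  have "dcube_weight p v = (\<Sum>l\<in>S. v (e l))"
    unfolding dcube_weight_def by (rule sum.reindex_bij_betw[OF e, symmetric])
  also have "\<dots> = (\<Sum>l\<in>S. if v (e l) = 1 then 1 else 0)"
    using dcube_value[OF v] e by (intro sum.cong) (auto simp: bij_betw_def)
  also have "\<dots> = card {l \<in> S. v (e l) = 1}"
    using S by (simp add: sum.If_cases Int_def)
  finally show "dcube_weight p v = card {l \<in> S. v (e l) = 1}" .
qed

text \<open>Up to sign the sum is the coefficient of the monomial \<open>S\<close>. With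
  \<open>d + 1\<close> directions singled out in \<open>S\<close>, it splits into signed sums over
  parallel faces of dimension \<open>d + 1\<close>, each of which lies in \<open>K\<close> by the
  degree bound.\<close>

lemma deg_le_top_coeff:
  assumes K: "add_subgroup K" and g: "deg_le K d n g" and S: "S \<subseteq> {..<n}" "d < card S"
  shows "(\<Sum>T\<in>Pow S. (-1) ^ card T * g (vind n T)) \<in> K"
proof -
  have fS: "finite S" using S(1) finite_subset by blast
  obtain S0 where S0: "S0 \<subseteq> S" "card S0 = d + 1" "finite S0"
    using S(2) obtain_subset_with_card_n[of "d + 1" S] by auto
  obtain e where e: "bij_betw e S0 {..<d + 1}"
    using S0 by (metis bij_betw_iff_card card_lessThan finite_lessThan)
  have "(\<Sum>T\<in>Pow S. (-1) ^ card T * g (vind n T)) =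
     (\<Sum>T1\<in>Pow (S - S0). \<Sum>T0\<in>Pow S0. (-1) ^ card (T0 \<union> T1) * g (vind n (T0 \<union> T1)))"
    unfolding sum.cartesian_product
    by (rule sum.reindex_bij_witness[of _ "\<lambda>(T1, T0). T0 \<union> T1" "\<lambda>T. (T - S0, T \<inter> S0)"])
      (use S0 in \<open>auto simp: Un_Diff Int_Un_distrib2 Int_Diff_Un Un_commute Un_Diff_Int\<close>)
  also have "\<dots> \<in> K"
  proof (rule subgroup_sum[OF K])
    fix T1 assume T1: "T1 \<in> Pow (S - S0)"
    then have fT1: "finite T1" and disj: "T0 \<inter> T1 = {}" if "T0 \<subseteq> S0" for T0
      using that fS by (auto intro: finite_subset)
    \<comment> \<open>Embeds the \<open>(d + 1)\<close>-cube as a face with directions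
      \<open>S0\<close>; the coordinates in \<open>T1\<close> are frozen at 1, all others at
      0.\<close>
    define \<phi> where "\<phi> = (\<lambda>v\<in>dcube (d + 1). vind n ({l \<in> S0. v (e l) = 1} \<union> T1))"
    have e_lt: "l \<in> S0 \<Longrightarrow> e l < d + 1" for l
      using e by (auto simp: bij_betw_def)
    have "\<phi> \<in> dcube_morphism (d + 1) n"
      unfolding dcube_morphism_def
    proof (intro CollectI conjI allI impI)
      show "\<phi> \<in> dcube (d + 1) \<rightarrow>\<^sub>E dcube n"
        by (auto simp: \<phi>_def)
      fix l assume l: "l < n"
      have "\<forall>v\<in>dcube (d + 1). \<phi> v l = v (e l)" if "l \<in> S0"
      proof
        fix v assume v: "v \<in> dcube (d + 1)"
        have "l \<notin> T1" using T1 that by auto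
        then show "\<phi> v l = v (e l)"
          using dcube_value[OF v e_lt[OF that]] v l that by (auto simp: \<phi>_def vind_def)
      qed
      then show "(\<forall>v\<in>dcube (d + 1). \<phi> v l = 0) \<or> (\<forall>v\<in>dcube (d + 1). \<phi> v l = 1) \<or>
         (\<exists>i<d + 1. \<forall>v\<in>dcube (d + 1). \<phi> v l = v i) \<or> (\<exists>i<d + 1. \<forall>v\<in>dcube (d + 1). \<phi> v l = 1 - v i)"
        using e_lt[of l] l by (cases "l \<in> S0"; cases "l \<in> T1") (auto simp: \<phi>_def vind_def)
    qed
    then have "altsum (d + 1) (\<lambda>v. g (\<phi> v)) \<in> K"
      using g by (simp add: deg_le_def)
    moreover have "altsum (d + 1) (\<lambda>v. g (\<phi> v)) = (\<Sum>T0\<in>Pow S0. (-1) ^ card T0 * g (vind n (T0 \<union> T1)))"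
      unfolding altsum_def
      by (subst sum.reindex_bij_betw[OF bij_betw_dcube_Pow(1)[OF e S0(3)], symmetric], rule sum.cong)
        (simp_all add: bij_betw_dcube_Pow(2)[OF e S0(3)] \<phi>_def del: One_nat_def Suc_eq_plus1 add_Suc_right add.right_neutral add_0_right)
    moreover have "(\<Sum>T0\<in>Pow S0. (-1) ^ card (T0 \<union> T1) * g (vind n (T0 \<union> T1))) =
        (-1) ^ card T1 * (\<Sum>T0\<in>Pow S0. (-1) ^ card T0 * g (vind n (T0 \<union> T1)))"
      unfolding sum_distrib_left
      using S0(3) by (intro sum.cong refl, subst card_Un_disjoint)
        (auto simp: disj fT1 power_add intro: finite_subset)
    ultimately show "(\<Sum>T0\<in>Pow S0. (-1) ^ card (T0 \<union> T1) * g (vind n (T0 \<union> T1))) \<in> K"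
      using subgroup_int_mult[OF K] by auto
  qed
  finally show ?thesis .
qed

text \<open>Moebius inversion over the subsets of \<open>{..<n}\<close>. The last clause is what
  allows integer cubes to be built from unit steps in \<open>int_cube_induct\<close>.\<close>

lemma deg_le_expansion:
  assumes K: "add_subgroup K" and g: "deg_le K d n g"
  shows "\<exists>a. (\<forall>v\<in>dcube n. g v = (\<Sum>S\<in>Pow {..<n}. a S * vmono S v)) \<and>
    (\<forall>S. S \<subseteq> {..<n} \<and> d < card S \<longrightarrow> a S \<in> K) \<and>
    ((\<forall>v\<in>dcube n. g v \<in> \<int>) \<longrightarrow> (\<forall>S. a S \<in> \<int>))"
proof (intro exI conjI ballI allI impI)
  define b where "b S = (\<Sum>T\<in>Pow S. (-1) ^ card T * g (vind n T))" for S
  define a where "a S = (-1) ^ card S * b S" for S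
  show "g v = (\<Sum>S\<in>Pow {..<n}. a S * vmono S v)" if v: "v \<in> dcube n" for v
  proof -
    define U where "U = {l. l < n \<and> v l = 1}"
    have "vind n U = v"
    proof
      fix l show "vind n U l = v l"
        using dcube_value[OF v, of l] v
        by (cases "l < n") (auto simp: vind_def U_def dcube_def PiE_iff extensional_def)
    qed
    then have "g v = g (vind n U)" by simp
    also have "\<dots> = (\<Sum>S\<in>Pow U. a S)"
      unfolding a_def by (rule inclusion_exclusion_symmetric) (auto simp: b_def U_def)
    also have "\<dots> = (\<Sum>S\<in>Pow {..<n}. a S * vmono S (vind n U))"
    proof (rule sum.mono_neutral_cong_left)
      show "\<forall>S\<in>Pow {..<n} - Pow U. a S * vmono S (vind n U) = 0"
        by (auto simp: vmono_vind)
      fix S assume "S \<in> Pow U"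
      then show "a S = a S * vmono S (vind n U)"
        by (subst vmono_vind) (auto simp: U_def)
    qed (auto simp: U_def)
    finally show ?thesis by (simp add: \<open>vind n U = v\<close>)
  qed
  show "a S \<in> K" if "S \<subseteq> {..<n} \<and> d < card S" for S
    unfolding a_def b_def using that by (intro subgroup_int_mult K deg_le_top_coeff[OF K g]) auto
  show "a S \<in> \<int>" if "\<forall>v\<in>dcube n. g v \<in> \<int>" for S
    using that by (force simp: a_def b_def intro!: Ints_mult Ints_sum)
qed

text \<open>The definition tests only morphisms from the \<open>(d + 1)\<close>-cube, so
  monotonicity is not immediate. In the expansion it is: each term has size at most \<open>d\<close>
  or a coefficient in \<open>K\<close>.\<close>

lemma deg_le_mono:
  assumes K: "add_subgroup K" and g: "deg_le K d n g" and d: "d \<le> d'"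
  shows "deg_le K d' n g"
proof -
  obtain a where
    a: "\<And>v. v \<in> dcube n \<Longrightarrow> g v = (\<Sum>S\<in>Pow {..<n}. a S * vmono S v)"
      "\<And>S. S \<subseteq> {..<n} \<Longrightarrow> d < card S \<Longrightarrow> a S \<in> K"
    using deg_le_expansion[OF K g] by metis
  have "deg_le K d' n (\<lambda>v. a S * vmono S v)" if "S \<subseteq> {..<n}" for S
    using that d a(2)[OF that] by (cases "card S \<le> d") (auto intro: deg_le_vmono K deg_le_vmono_in)
  then have "deg_le K d' n (\<lambda>v. \<Sum>S\<in>Pow {..<n}. a S * vmono S v)"
    by (intro deg_le_sum[OF K]) auto
  then show ?thesis
    by (rule deg_le_eqI) (rule a(1))
qed

text \<open>Vertex coordinates are idempotent, so multiplication by \<open>v l\<close> turns the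
  monomial \<open>S\<close> into \<open>insert l S\<close>: the size grows by at most one and the
  coefficient is kept.\<close>

lemma deg_le_coord_mult:
  assumes K: "add_subgroup K" and g: "deg_le K d n g" and l: "l < n"
  shows "deg_le K (d + 1) n (\<lambda>v. real (v l) * g v)"
proof -
  obtain a where
    a: "\<And>v. v \<in> dcube n \<Longrightarrow> g v = (\<Sum>S\<in>Pow {..<n}. a S * vmono S v)"
      "\<And>S. S \<subseteq> {..<n} \<Longrightarrow> d < card S \<Longrightarrow> a S \<in> K"
    using deg_le_expansion[OF K g] by metis
  have eq: "real (v l) * g v = (\<Sum>S\<in>Pow {..<n}. a S * vmono (insert l S) v)" if v: "v \<in> dcube n" for v
    unfolding a(1)[OF v] sum_distrib_left
  proof (intro sum.cong refl)
    fix S assume "S \<in> Pow {..<n}"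
    then have "vmono {l} v * vmono S v = vmono (insert l S) v"
      using vmono_mult[OF v, of "{l}" S] l by simp
    then show "real (v l) * (a S * vmono S v) = a S * vmono (insert l S) v"
      by (simp add: vmono_def[of "{l}"] mult_ac)
  qed
  have "deg_le K (d + 1) n (\<lambda>v. a S * vmono (insert l S) v)" if S: "S \<subseteq> {..<n}" for S
  proof (cases "card S \<le> d")
    case True
    have "finite S" using S finite_subset by blast
    then have "card (insert l S) \<le> d + 1" using True by (simp add: card_insert_if)
    then show ?thesis using S l by (intro deg_le_vmono K) auto
  next
    case False
    then show ?thesis using a(2)[OF S] by (auto intro: deg_le_vmono_in K)
  qed
  then have "deg_le K (d + 1) n (\<lambda>v. \<Sum>S\<in>Pow {..<n}. a S * vmono (insert l S) v)"
    by (intro deg_le_sum[OF K]) auto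
  then show ?thesis
    by (rule deg_le_eqI) (rule eq)
qed

lemma deg_le_vmono_mult:
  assumes K: "add_subgroup K" and g: "deg_le K d n g" and S: "S \<subseteq> {..<n}"
  shows "deg_le K (d + card S) n (\<lambda>v. vmono S v * g v)"
proof -
  have "finite S" using S finite_subset by blast
  then show ?thesis using S
  proof (induction S)
    case empty then show ?case using g by simp
  next
    case (insert l S)
    then have "deg_le K (d + card S + 1) n (\<lambda>v. real (v l) * (vmono S v * g v))"
      by (intro deg_le_coord_mult K) auto
    then show ?case using insert by (simp add: vmono_def mult_ac)
  qed
qed

text \<open>The indicator of a face of codimension 1 is \<open>v l\<close> or
  \<open>1 - v l\<close>, so each fixed coordinate costs one degree. This is why a map of degree
  \<open>k - i\<close> can be added on faces of codimension \<open>i\<close>.\<close>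

lemma deg_le_face:
  assumes K: "add_subgroup K" and g: "deg_le K d n g" and F: "F \<in> dcube_faces n i"
  shows "deg_le K (d + i) n (\<lambda>v. if v \<in> F then g v else 0)"
proof -
  obtain J w where J: "F = {v \<in> dcube n. \<forall>j\<in>J. v j = w j}" "J \<subseteq> {..<n}" "card J = i" "w \<in> J \<rightarrow> {0,1}"
    using F by (auto simp: dcube_faces_def)
  have "finite J" using J finite_subset by blast
  have "finite T \<Longrightarrow> T \<subseteq> J \<Longrightarrow> deg_le K (d + card T) n (\<lambda>v. if \<forall>j\<in>T. v j = w j then g v else 0)" for T
  proof (induction T rule: finite_induct)
    case empty then show ?case using g by simp
  next
    case (insert l T)
    define f where "f = (\<lambda>v. if \<forall>j\<in>T. v j = w j then g v else 0)"
    have f: "deg_le K (d + card T) n f"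
      unfolding f_def using insert by auto
    have l: "l < n" "w l \<in> {0, 1}" using insert.prems J by auto
    have f1: "deg_le K (d + card T + 1) n (\<lambda>v. real (v l) * f v)"
      by (rule deg_le_coord_mult[OF K f l(1)])
    have f0: "deg_le K (d + card T + 1) n (\<lambda>v. f v - real (v l) * f v)"
      by (rule deg_le_diff[OF K _ f1]) (rule deg_le_mono[OF K f], simp)
    have "deg_le K (d + card T + 1) n (\<lambda>v. if \<forall>j\<in>insert l T. v j = w j then g v else 0)"
    proof (cases "w l = 0")
      case True
      have "(if \<forall>j\<in>insert l T. v j = w j then g v else 0) = f v - real (v l) * f v" if "v \<in> dcube n" for v
        using dcube_value[OF that l(1)] True by (auto simp: f_def)
      then show ?thesis
        using f0 by (subst deg_le_cong)
    next
      case False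
      then have "w l = 1" using l by auto
      have "(if \<forall>j\<in>insert l T. v j = w j then g v else 0) = real (v l) * f v" if "v \<in> dcube n" for v
        using dcube_value[OF that l(1)] \<open>w l = 1\<close> by (auto simp: f_def)
      then show ?thesis
        using f1 by (subst deg_le_cong)
    qed
    then show ?case using insert by simp
  qed
  from this[OF \<open>finite J\<close> order_refl] have "deg_le K (d + i) n (\<lambda>v. if \<forall>j\<in>J. v j = w j then g v else 0)"
    using J by simp
  then show ?thesis
    by (subst deg_le_cong) (auto simp: J(1))
qed

lemma deg_le_pullback:
  assumes K: "add_subgroup K" and g: "deg_le K d n g" and n: "n \<le> m"
  shows "deg_le K d m (\<lambda>v. g (restrict v {..<n}))"
proof -
  obtain a where
    a: "\<And>v. v \<in> dcube n \<Longrightarrow> g v = (\<Sum>S\<in>Pow {..<n}. a S * vmono S v)"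
      "\<And>S. S \<subseteq> {..<n} \<Longrightarrow> d < card S \<Longrightarrow> a S \<in> K"
    using deg_le_expansion[OF K g] by metis
  have eq: "g (restrict v {..<n}) = (\<Sum>S\<in>Pow {..<n}. a S * vmono S v)" if v: "v \<in> dcube m" for v
    by (subst a(1)[OF dcube_restrict[OF v n]]) (auto intro!: sum.cong simp: vmono_restrict)
  have "deg_le K d m (\<lambda>v. a S * vmono S v)" if S: "S \<subseteq> {..<n}" for S
  proof (cases "card S \<le> d")
    case True
    then show ?thesis using S n by (intro deg_le_vmono K) auto
  next
    case False
    then show ?thesis using a(2)[OF S] by (auto intro: deg_le_vmono_in K)
  qed
  then have "deg_le K d m (\<lambda>v. \<Sum>S\<in>Pow {..<n}. a S * vmono S v)"
    by (intro deg_le_sum[OF K]) auto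
  then show ?thesis
    by (rule deg_le_eqI) (rule eq)
qed

section \<open>Fresh coordinates and leading coefficients\<close>

lemma altsum_last_coord:
  "altsum (p + 1) (\<lambda>v. real (v p) * g (restrict v {..<p})) = - altsum p g"
proof -
  define f where "f u = u(p := 1::nat)" for u :: "nat \<Rightarrow> nat"
  have "altsum (p + 1) (\<lambda>v. real (v p) * g (restrict v {..<p})) =
      (\<Sum>v\<in>{v \<in> dcube (p + 1). v p = 1}. (-1) ^ dcube_weight (p + 1) v * (real (v p) * g (restrict v {..<p})))"
    unfolding altsum_def
  proof (rule sum.mono_neutral_right)
    show "\<forall>v\<in>dcube (p + 1) - {v \<in> dcube (p + 1). v p = 1}.
        (-1) ^ dcube_weight (p + 1) v * (real (v p) * g (restrict v {..<p})) = 0"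
      using dcube_value[of _ "p + 1" p] by fastforce
  qed (auto simp: finite_dcube)
  also have "\<dots> = (\<Sum>u\<in>dcube p. - ((-1) ^ dcube_weight p u * g u))"
  proof (rule sum.reindex_bij_witness[of _ f "\<lambda>v. restrict v {..<p}"])
    fix v assume v: "v \<in> {v \<in> dcube (p + 1). v p = 1}"
    then show "f (restrict v {..<p}) = v"
      by (auto simp: f_def dcube_def PiE_iff extensional_def fun_eq_iff)
    show "restrict v {..<p} \<in> dcube p"
      using v by (auto intro!: dcube_restrict[of _ "p + 1"])
    have "dcube_weight (p + 1) v = dcube_weight p (restrict v {..<p}) + 1"
      using v by (simp add: dcube_weight_def)
    then show "- ((-1) ^ dcube_weight p (restrict v {..<p}) * g (restrict v {..<p})) =
        (-1) ^ dcube_weight (p + 1) v * (real (v p) * g (restrict v {..<p}))"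
      using v by simp
  next
    fix u assume u: "u \<in> dcube p"
    show "restrict (f u) {..<p} = u"
      using u by (auto simp: f_def dcube_def PiE_iff extensional_def fun_eq_iff)
    show "f u \<in> {v \<in> dcube (p + 1). v p = 1}"
      using u by (auto simp: f_def dcube_def PiE_iff extensional_def less_Suc_eq)
  qed
  finally show ?thesis
    by (simp add: altsum_def sum_negf)
qed

text \<open>A converse of \<open>deg_le_coord_mult\<close> for a coordinate on which
  \<open>g\<close> does not depend. A test morphism for \<open>g\<close> gets one more input, which
  drives only the new coordinate; the larger signed sum is the old one up to sign.\<close>

lemma deg_le_drop_coord:
  assumes K: "add_subgroup K" and g: "deg_le K (d + 1) (n + 1) (\<lambda>v. real (v n) * g (restrict v {..<n}))"
  shows "deg_le K d n g"
  unfolding deg_le_def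
proof
  fix \<phi> assume \<phi>: "\<phi> \<in> dcube_morphism (d + 1) n"
  define \<psi> where "\<psi> = (\<lambda>v\<in>dcube (d + 1 + 1). \<lambda>l\<in>{..<n + 1}.
      if l < n then \<phi> (restrict v {..<d + 1}) l else v (d + 1))"
  have \<psi>n: "\<psi> v n = v (d + 1)" if "v \<in> dcube (d + 1 + 1)" for v
    using that by (simp add: \<psi>_def)
  have \<psi>l: "\<psi> v l = \<phi> (restrict v {..<d + 1}) l" if "v \<in> dcube (d + 1 + 1)" "l < n" for v l
    using that by (simp add: \<psi>_def)
  have \<psi>r: "restrict (\<psi> v) {..<n} = \<phi> (restrict v {..<d + 1})" if v: "v \<in> dcube (d + 1 + 1)" for v
  proof
    have "\<phi> (restrict v {..<d + 1}) \<in> dcube n"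
      using \<phi> dcube_restrict[OF v] by (intro dcube_morphism_app[OF \<phi>]) auto
    then show "restrict (\<psi> v) {..<n} l = \<phi> (restrict v {..<d + 1}) l" for l
      using \<psi>l[OF v, of l] by (auto simp: dcube_def PiE_iff extensional_def)
  qed
  have "\<psi> \<in> dcube_morphism (d + 1 + 1) (n + 1)"
    unfolding dcube_morphism_def
  proof (intro CollectI conjI allI impI)
    show "\<psi> \<in> dcube (d + 1 + 1) \<rightarrow>\<^sub>E dcube (n + 1)"
    proof
      fix v assume v: "v \<in> dcube (d + 1 + 1)"
      have "restrict (\<psi> v) {..<n} \<in> dcube n"
        unfolding \<psi>r[OF v] by (intro dcube_morphism_app[OF \<phi>] dcube_restrict[OF v]) simp
      then have "\<psi> v l \<in> {0,1}" if "l < n" for l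
        using dcube_value[of _ n l] that by fastforce
      moreover have "\<psi> v n \<in> {0,1}"
        using dcube_value[OF v, of "d + 1"] \<psi>n[OF v] by simp
      moreover have "\<psi> v \<in> extensional {..<n + 1}"
        using v by (simp add: \<psi>_def)
      ultimately show "\<psi> v \<in> dcube (n + 1)"
        unfolding dcube_def PiE_iff by (metis Suc_eq_plus1 lessThan_iff less_Suc_eq)
    qed (simp add: \<psi>_def)
    fix l assume l: "l < n + 1"
    show "(\<forall>v\<in>dcube (d + 1 + 1). \<psi> v l = 0) \<or> (\<forall>v\<in>dcube (d + 1 + 1). \<psi> v l = 1) \<or>
         (\<exists>i<d + 1 + 1. \<forall>v\<in>dcube (d + 1 + 1). \<psi> v l = v i) \<or>
         (\<exists>i<d + 1 + 1. \<forall>v\<in>dcube (d + 1 + 1). \<psi> v l = 1 - v i)"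
    proof (cases "l < n")
      case True
      have r: "restrict v {..<d + 1} \<in> dcube (d + 1)" if "v \<in> dcube (d + 1 + 1)" for v
        using dcube_restrict[OF that] by simp
      have "(\<forall>v\<in>dcube (d + 1). \<phi> v l = 0) \<or> (\<forall>v\<in>dcube (d + 1). \<phi> v l = 1) \<or>
         (\<exists>i<d + 1. \<forall>v\<in>dcube (d + 1). \<phi> v l = v i) \<or> (\<exists>i<d + 1. \<forall>v\<in>dcube (d + 1). \<phi> v l = 1 - v i)"
        using \<phi> True by (simp add: dcube_morphism_def)
      then consider "\<forall>v\<in>dcube (d + 1). \<phi> v l = 0" | "\<forall>v\<in>dcube (d + 1). \<phi> v l = 1"
        | i where "i < d + 1" "\<forall>v\<in>dcube (d + 1). \<phi> v l = v i"
        | i where "i < d + 1" "\<forall>v\<in>dcube (d + 1). \<phi> v l = 1 - v i" by metis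
      then show ?thesis
      proof cases
        case 1 then show ?thesis using \<psi>l True r by simp
      next
        case 2 then show ?thesis using \<psi>l True r by simp
      next
        case (3 i)
        then have "\<forall>v\<in>dcube (d + 1 + 1). \<psi> v l = v i"
          using \<psi>l True r by simp
        then show ?thesis using 3(1) by (metis trans_less_add1)
      next
        case (4 i)
        then have "\<forall>v\<in>dcube (d + 1 + 1). \<psi> v l = 1 - v i"
          using \<psi>l True r by simp
        then show ?thesis using 4(1) by (metis trans_less_add1)
      qed
    next
      case False
      then have "l = n" using l by simp
      then show ?thesis using \<psi>n by (metis less_add_one)
    qed
  qed
  then have "altsum (d + 1 + 1) (\<lambda>v. real (\<psi> v n) * g (restrict (\<psi> v) {..<n})) \<in> K"
    using g unfolding deg_le_def by blast
  moreover have "altsum (d + 1 + 1) (\<lambda>v. real (\<psi> v n) * g (restrict (\<psi> v) {..<n})) =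
      altsum (d + 1 + 1) (\<lambda>v. real (v (d + 1)) * g (\<phi> (restrict v {..<d + 1})))"
    by (rule altsum_cong) (simp only: \<psi>n \<psi>r)
  ultimately show "altsum (d + 1) (\<lambda>v. g (\<phi> v)) \<in> K"
    by (simp only: altsum_last_coord[of "d + 1" "\<lambda>v. g (\<phi> v)"] subgroup_minus_iff[OF K])
qed

text \<open>The source of all lowered degrees: a change made only where \<open>q\<close> fresh
  coordinates equal 1 is measured in dimension \<open>n + q\<close>, and its amount, as a function
  on the \<open>n\<close>-cube, has degree smaller by \<open>q\<close>.\<close>

lemma deg_le_drop_coords:
  assumes K: "add_subgroup K"
  shows "deg_le K (d + q) (n + q) (\<lambda>v. vmono {n..<n + q} v * g (restrict v {..<n})) \<Longrightarrow> deg_le K d n g"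
proof (induction q)
  case 0
  have "deg_le K d n (\<lambda>v. g (restrict v {..<n})) \<longleftrightarrow> deg_le K d n g"
  proof (rule deg_le_cong)
    fix v assume "v \<in> dcube n"
    then have "restrict v {..<n} = v" by (auto simp: dcube_def PiE_iff extensional_def fun_eq_iff)
    then show "g (restrict v {..<n}) = g v" by simp
  qed
  then show ?case using "0.prems" by (simp only: add_0_right atLeastLessThan_empty[OF order_refl] vmono_empty mult_1)
next
  case (Suc q)
  have "vmono {n..<n + Suc q} v * g (restrict v {..<n}) =
     real (v (n + q)) * (vmono {n..<n + q} (restrict v {..<n + q}) * g (restrict (restrict v {..<n + q}) {..<n}))" for v
  proof -
    have "vmono {n..<n + q} (restrict v {..<n + q}) = vmono {n..<n + q} v"
      by (rule vmono_restrict) auto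
    moreover have "restrict (restrict v {..<n + q}) {..<n} = restrict v {..<n}"
      by (auto simp: fun_eq_iff)
    ultimately show ?thesis by (simp add: vmono_def mult_ac)
  qed
  then have "deg_le K (d + q + 1) (n + q + 1) (\<lambda>v. real (v (n + q)) *
      (vmono {n..<n + q} (restrict v {..<n + q}) * g (restrict (restrict v {..<n + q}) {..<n})))"
    using Suc.prems by (simp only: Suc_eq_plus1 add.assoc)
  from deg_le_drop_coord[OF K, where g = "\<lambda>u. vmono {n..<n + q} u * g (restrict u {..<n})", OF this]
  show ?case by (rule Suc.IH)
qed

lemma altsum_vmono_full: "altsum p (vmono {..<p}) = (-1) ^ p"
proof -
  have "altsum p (vmono {..<p}) = (\<Sum>v\<in>{vind p {..<p}}. (-1) ^ dcube_weight p v * vmono {..<p} v)"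
    unfolding altsum_def
  proof (rule sum.mono_neutral_right[OF finite_dcube])
    show "\<forall>v\<in>dcube p - {vind p {..<p}}. (-1) ^ dcube_weight p v * vmono {..<p} v = 0"
    proof
      fix v assume v: "v \<in> dcube p - {vind p {..<p}}"
      then have "\<not> (\<forall>l\<in>{..<p}. v l = 1)"
        by (auto simp: vind_def dcube_def PiE_iff extensional_def fun_eq_iff split: if_splits)
      then show "(-1) ^ dcube_weight p v * vmono {..<p} v = 0"
        using v by (subst vmono_eq[of _ p]) auto
    qed
  qed simp
  also have "\<dots> = (-1) ^ p"
    by (simp add: vmono_vind) (simp add: dcube_weight_def vind_def)
  finally show ?thesis .
qed

text \<open>In dimension \<open>d + 1\<close> the signed sum sends functions of degree
  \<open>d\<close> into \<open>K\<close> and the full monomial to a sign, so it isolates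
  \<open>x\<close>.\<close>

lemma deg_le_leading_coeff:
  assumes K: "add_subgroup K" and g: "deg_le K d (d + 1) g"
    and g': "deg_le K d (d + 1) g'" "\<And>v. v \<in> dcube (d + 1) \<Longrightarrow> g v = g' v + x * vmono {..<d + 1} v"
  shows "x \<in> K"
proof -
  have "deg_le K d (d + 1) (\<lambda>v. g v - g' v)"
    by (rule deg_le_diff[OF K g g'(1)])
  then have 1: "deg_le K d (d + 1) (\<lambda>v. x * vmono {..<d + 1} v)"
    by (subst (asm) deg_le_cong) (auto simp: g'(2))
  have "restrict (\<lambda>v. v) (dcube (d + 1)) \<in> dcube_morphism (d + 1) (d + 1)"
    by (auto simp: dcube_morphism_def)
  then have "altsum (d + 1) (\<lambda>v. x * vmono {..<d + 1} (restrict (\<lambda>v. v) (dcube (d + 1)) v)) \<in> K"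
    using 1 unfolding deg_le_def by blast
  moreover have "altsum (d + 1) (\<lambda>v. x * vmono {..<d + 1} (restrict (\<lambda>v. v) (dcube (d + 1)) v)) =
     altsum (d + 1) (\<lambda>v. x * vmono {..<d + 1} v)"
    by (rule altsum_cong) simp
  ultimately have "x * (-1) ^ (d + 1) \<in> K"
    by (simp only: altsum_cmult altsum_vmono_full)
  then have "(-1) ^ (d + 1) * (x * (-1) ^ (d + 1)) \<in> K"
    by (rule subgroup_int_mult[OF K, rotated]) (rule Ints_power, simp)
  then show ?thesis
    by (simp add: mult_ac power_mult_distrib[symmetric] del: power_Suc)
qed

section \<open>Lifting morphisms on lattices\<close>

text \<open>The integer twin of \<open>vmono\<close>, used as the unit step by which integer cubes
  are changed.\<close>

definition vertex_ind :: "nat set \<Rightarrow> (nat \<Rightarrow> nat) \<Rightarrow> int" where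
  "vertex_ind S v = (if \<forall>l\<in>S. v l = 1 then 1 else 0)"

lemma of_int_vertex_ind:
  "v \<in> dcube n \<Longrightarrow> S \<subseteq> {..<n} \<Longrightarrow> real_of_int (vertex_ind S v) = vmono S v"
  by (simp add: vertex_ind_def vmono_eq)

text \<open>By the expansion with integer coefficients, an integer cube of degree \<open>q\<close>
  is reached from 0 by adding and subtracting indicators with \<open>card S \<le> q\<close>. The
  clause \<open>cong\<close> is there because the expansion fixes \<open>c\<close> on vertices
  only.\<close>

lemma int_cube_induct [consumes 1, case_names zero add diff cong]:
  fixes c :: "(nat \<Rightarrow> nat) \<Rightarrow> int"
  assumes c: "deg_le {0} q n (\<lambda>v. real_of_int (c v))"
    and zero: "P (\<lambda>v. 0)"
    and add: "\<And>c S. P c \<Longrightarrow> S \<subseteq> {..<n} \<Longrightarrow> card S \<le> q \<Longrightarrow> P (\<lambda>v. c v + vertex_ind S v)"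
    and diff: "\<And>c S. P c \<Longrightarrow> S \<subseteq> {..<n} \<Longrightarrow> card S \<le> q \<Longrightarrow> P (\<lambda>v. c v - vertex_ind S v)"
    and cong: "\<And>c c'. P c \<Longrightarrow> (\<And>v. v \<in> dcube n \<Longrightarrow> c v = c' v) \<Longrightarrow> P c'"
  shows "P c"
proof -
  obtain a where a: "\<And>v. v \<in> dcube n \<Longrightarrow> real_of_int (c v) = (\<Sum>S\<in>Pow {..<n}. a S * vmono S v)"
      "\<And>S. S \<subseteq> {..<n} \<Longrightarrow> q < card S \<Longrightarrow> a S = 0" "\<And>S. a S \<in> \<int>"
    using deg_le_expansion[OF add_subgroup_zero c] by auto
  have "\<exists>A. \<forall>S. a S = real_of_int (A S)"
    using a(3) by (intro choice) (auto elim: Ints_cases)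
  then obtain A where A: "\<And>S. a S = real_of_int (A S)" by blast
  have mult: "P (\<lambda>v. b v + z * vertex_ind S v)" if "P b" "S \<subseteq> {..<n}" "card S \<le> q" for b z S
  proof (induction z rule: int_induct[of _ 0])
    case base then show ?case using that by simp
  next
    case (step1 z) then show ?case using add[OF step1(2) that(2,3)] by (simp add: algebra_simps)
  next
    case (step2 z) then show ?case using diff[OF step2(2) that(2,3)] by (simp add: algebra_simps)
  qed
  have "finite \<S> \<Longrightarrow> \<S> \<subseteq> Pow {..<n} \<Longrightarrow> P (\<lambda>v. \<Sum>S\<in>\<S>. A S * vertex_ind S v)" for \<S>
  proof (induction \<S> rule: finite_induct)
    case empty then show ?case using zero by simp
  next
    case (insert S \<S>)
    show ?case
    proof (cases "card S \<le> q")
      case True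
      have "P (\<lambda>v. (\<Sum>S\<in>\<S>. A S * vertex_ind S v) + A S * vertex_ind S v)"
        using insert True by (intro mult) auto
      then show ?thesis using insert.hyps by (simp add: add.commute)
    next
      case False
      then have "A S = 0" using a(2)[of S] insert.prems A[of S] by simp
      then show ?thesis using insert by simp
    qed
  qed
  then have "P (\<lambda>v. \<Sum>S\<in>Pow {..<n}. A S * vertex_ind S v)"
    by simp
  then show ?thesis
  proof (rule cong)
    fix v assume v: "v \<in> dcube n"
    have "real_of_int (\<Sum>S\<in>Pow {..<n}. A S * vertex_ind S v) = real_of_int (c v)"
      unfolding a(1)[OF v] by (simp add: A of_int_vertex_ind[OF v])
    then show "(\<Sum>S\<in>Pow {..<n}. A S * vertex_ind S v) = c v" by (simp only: of_int_eq_iff)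
  qed
qed

text \<open>The cubes of the product over \<open>E\<close> of the degree-\<open>wt e\<close>
  nilspaces on \<int>. Points are total functions vanishing off \<open>E\<close>, so that enlarging
  \<open>E\<close> keeps them points.\<close>

definition lattice_cube :: "'e set \<Rightarrow> ('e \<Rightarrow> nat) \<Rightarrow> nat \<Rightarrow> ((nat \<Rightarrow> nat) \<Rightarrow> 'e \<Rightarrow> int) \<Rightarrow> bool" where
  "lattice_cube E wt n c \<longleftrightarrow>
    (\<forall>v\<in>dcube n. \<forall>e. e \<notin> E \<longrightarrow> c v e = 0) \<and>
    (\<forall>e\<in>E. deg_le {0} (wt e) n (\<lambda>v. real_of_int (c v e)))"

definition lattice_morphism :: "real set \<Rightarrow> 'e set \<Rightarrow> ('e \<Rightarrow> nat) \<Rightarrow> nat \<Rightarrow> (('e \<Rightarrow> int) \<Rightarrow> real) \<Rightarrow> bool" where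
  "lattice_morphism K E wt d w \<longleftrightarrow> (\<forall>n c. lattice_cube E wt n c \<longrightarrow> deg_le K d n (\<lambda>v. w (c v)))"

lemma lattice_cube_upd:
  assumes "lattice_cube E wt n c" "e \<in> E" "deg_le {0} (wt e) n (\<lambda>v. real_of_int (b v))"
  shows "lattice_cube E wt n (\<lambda>v. (c v)(e := b v))"
  unfolding lattice_cube_def
proof (intro conjI ballI)
  fix e' assume "e' \<in> E"
  then show "deg_le {0} (wt e') n (\<lambda>v. real_of_int (((c v)(e := b v)) e'))"
    using assms by (cases "e' = e") (auto simp: lattice_cube_def)
qed (use assms in \<open>auto simp: lattice_cube_def\<close>)

lemma deg_le_vertex_ind:
  assumes "S \<subseteq> {..<n}" "card S \<le> q"
  shows "deg_le {0} q n (\<lambda>v. real_of_int (vertex_ind S v))"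
  by (rule deg_le_eqI[OF deg_le_vmono[OF add_subgroup_zero assms, of 1]])
    (simp add: of_int_vertex_ind assms(1))

lemma lattice_cube_add:
  assumes "lattice_cube E wt n c" "e \<in> E" "S \<subseteq> {..<n}" "card S \<le> wt e"
  shows "lattice_cube E wt n (\<lambda>v. (c v)(e := c v e + vertex_ind S v))"
  using assms deg_le_add[OF add_subgroup_zero _ deg_le_vertex_ind[OF assms(3,4)]]
  by (intro lattice_cube_upd) (auto simp: lattice_cube_def)

lemma lattice_cube_pullback:
  assumes "lattice_cube E wt n c" "n \<le> m"
  shows "lattice_cube E wt m (\<lambda>v. c (restrict v {..<n}))"
  using assms deg_le_pullback[OF add_subgroup_zero _ assms(2)]
  unfolding lattice_cube_def by (blast intro: dcube_restrict)

text \<open>In \<open>wt e\<close> fresh dimensions, coordinate \<open>e\<close> may be raised by 1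
  where all new coordinates are 1, since the indicator of that face has degree \<open>wt e\<close>.
  The change of \<open>w\<close> is the difference times this indicator, and dropping the fresh
  coordinates lowers the degree.\<close>

lemma lattice_morphism_diff:
  assumes K: "add_subgroup K" and w: "lattice_morphism K E wt d w" and e: "e \<in> E" "wt e \<le> d"
  shows "lattice_morphism K E wt (d - wt e) (\<lambda>m. w (m(e := m e + 1)) - w m)"
  unfolding lattice_morphism_def
proof (intro allI impI)
  fix n c assume c: "lattice_cube E wt n c"
  define q where "q = wt e"
  define c1 where "c1 = (\<lambda>v. c (restrict v {..<n}))"
  define c2 where "c2 = (\<lambda>v. (c1 v)(e := c1 v e + vertex_ind {n..<n + q} v))"
  have c1: "lattice_cube E wt (n + q) c1"
    unfolding c1_def by (rule lattice_cube_pullback[OF c]) simp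
  have c2: "lattice_cube E wt (n + q) c2"
    unfolding c2_def by (rule lattice_cube_add[OF c1 e(1)]) (auto simp: q_def)
  have "deg_le K d (n + q) (\<lambda>v. w (c2 v) - w (c1 v))"
    using w c1 c2 by (intro deg_le_diff K) (auto simp: lattice_morphism_def)
  then have "deg_le K d (n + q) (\<lambda>v. vmono {n..<n + q} v *
      (w ((c (restrict v {..<n}))(e := c (restrict v {..<n}) e + 1)) - w (c (restrict v {..<n}))))"
  proof (rule deg_le_eqI)
    fix v assume v: "v \<in> dcube (n + q)"
    show "vmono {n..<n + q} v *
      (w ((c (restrict v {..<n}))(e := c (restrict v {..<n}) e + 1)) - w (c (restrict v {..<n})))
      = w (c2 v) - w (c1 v)"
      by (subst of_int_vertex_ind[OF v, symmetric]) (auto simp: vertex_ind_def c2_def c1_def)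
  qed
  then have "deg_le K (d - q + q) (n + q) (\<lambda>v. vmono {n..<n + q} v *
      (w ((c (restrict v {..<n}))(e := c (restrict v {..<n}) e + 1)) - w (c (restrict v {..<n}))))"
    using e by (simp add: q_def)
  from deg_le_drop_coords[OF K, where g = "\<lambda>u. w ((c u)(e := c u e + 1)) - w (c u)", OF this]
  show "deg_le K (d - wt e) n (\<lambda>u. w ((c u)(e := c u e + 1)) - w (c u))"
    by (simp add: q_def)
qed

lemma lattice_cube_const:
  assumes "\<And>e. e \<notin> E \<Longrightarrow> m e = 0"
  shows "lattice_cube E wt n (\<lambda>_. m)"
  using assms by (auto simp: lattice_cube_def intro!: deg_le_const)

text \<open>For \<open>d < wt e\<close>, raising coordinate \<open>e\<close> at a single vertex of a
  constant \<open>(d + 1)\<close>-cube still gives a cube, so the increment is a leading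
  coefficient: \<open>w\<close> is periodic modulo \<open>K\<close> in direction
  \<open>e\<close>.\<close>

lemma lattice_morphism_diff_high:
  assumes K: "add_subgroup K" and w: "lattice_morphism K E wt d w" and e: "e \<in> E" "d < wt e"
    and m: "\<And>e. e \<notin> E \<Longrightarrow> m e = 0"
  shows "w (m(e := m e + 1)) - w m \<in> K"
proof -
  define c where "c = (\<lambda>v. m(e := m e + vertex_ind {..<d + 1} v))"
  have c: "lattice_cube E wt (d + 1) c"
    unfolding c_def using lattice_cube_add[OF lattice_cube_const[OF m] e(1), where S = "{..<d + 1}" and n = "d + 1" and wt = wt] e by simp
  then have "deg_le K d (d + 1) (\<lambda>v. w (c v))"
    using w by (auto simp: lattice_morphism_def)
  then show ?thesis
  proof (rule deg_le_leading_coeff[OF K])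
    show "deg_le K d (d + 1) (\<lambda>v. w m)" by (rule deg_le_const[OF K])
    fix v assume v: "v \<in> dcube (d + 1)"
    show "w (c v) = w m + (w (m(e := m e + 1)) - w m) * vmono {..<d + 1} v"
      by (subst of_int_vertex_ind[OF v, symmetric]) (auto simp: vertex_ind_def c_def)
  qed
qed

text \<open>The discrete integral from 0 to \<open>t\<close>, signed so that
  \<open>int_sum_step\<close> holds for negative \<open>t\<close> too.\<close>

definition int_sum :: "(int \<Rightarrow> real) \<Rightarrow> int \<Rightarrow> real" where
  "int_sum f t = (if 0 \<le> t then \<Sum>i\<in>{0..<t}. f i else - (\<Sum>i\<in>{t..<0}. f i))"

lemma int_sum_0 [simp]: "int_sum f 0 = 0"
  by (simp add: int_sum_def)

lemma int_sum_step: "int_sum f (t + 1) = int_sum f t + f t"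
proof (cases "0 \<le> t")
  case True
  then have "{0..<t + 1} = insert t {0..<t}" by auto
  then show ?thesis using True by (simp add: int_sum_def)
next
  case False
  then have "{t..<0} = insert t {t + 1..<0}" by auto
  then show ?thesis using False by (auto simp: int_sum_def)
qed

text \<open>Coordinate \<open>e\<close> of a cube is built from 0 by unit steps with
  \<open>card S \<le> wt e\<close>, and each changes \<open>W\<close> by a term of the kind in
  \<open>degQ\<close>. That hypothesis bounds the products and not \<open>Q\<close> itself, because
  for \<open>d < wt e\<close> there is no degree \<open>d - wt e\<close> to ask for.\<close>

lemma lattice_morphism_integrate:
  assumes e: "e \<notin> E" and W0: "lattice_morphism {0} E wt d (\<lambda>m. W (m(e := 0)))"
    and Q: "\<And>m. W (m(e := m e + 1)) = W m + Q m"
    and degQ: "\<And>n c S. lattice_cube (insert e E) wt n c \<Longrightarrow> S \<subseteq> {..<n} \<Longrightarrow> card S \<le> wt e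
       \<Longrightarrow> deg_le {0} d n (\<lambda>v. vmono S v * Q (c v))"
  shows "lattice_morphism {0} (insert e E) wt d W"
  unfolding lattice_morphism_def
proof (intro allI impI)
  fix n c assume c: "lattice_cube (insert e E) wt n c"
  have Qadd: "W (m(e := t + vertex_ind S v)) = W (m(e := t)) + vmono S v * Q (m(e := t))"
    if "v \<in> dcube n" "S \<subseteq> {..<n}" for m t S v
    using Q[of "m(e := t)"] by (subst of_int_vertex_ind[OF that, symmetric]) (auto simp: vertex_ind_def)
  \<comment> \<open>The degree of \<open>b\<close> is part of the predicate, since
    \<open>degQ\<close> applies only to cubes.\<close>
  define P where "P b \<longleftrightarrow> deg_le {0} (wt e) n (\<lambda>v. real_of_int (b v)) \<and>
      deg_le {0} d n (\<lambda>v. W ((c v)(e := b v)))" for b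
  have "deg_le {0} (wt e) n (\<lambda>v. real_of_int (c v e))"
    using c by (auto simp: lattice_cube_def)
  then have "P (\<lambda>v. c v e)"
  proof (induction rule: int_cube_induct)
    case zero
    have "((c v)(e := 0)) e' = c v e'" if "e' \<in> E" for e' v
      using that e by auto
    then have "lattice_cube E wt n (\<lambda>v. (c v)(e := 0))"
      using c unfolding lattice_cube_def by auto
    then have "deg_le {0} d n (\<lambda>v. W (((c v)(e := 0))(e := 0)))"
      using W0 unfolding lattice_morphism_def by blast
    then show ?case by (simp add: P_def deg_le_const)
  next
    case (add b S)
    then have "lattice_cube (insert e E) wt n (\<lambda>v. (c v)(e := b v))"
      by (intro lattice_cube_upd c) (auto simp: P_def)
    then have "deg_le {0} d n (\<lambda>v. W ((c v)(e := b v)) + vmono S v * Q ((c v)(e := b v)))"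
      using add by (intro deg_le_add degQ) (auto simp: P_def)
    then have "deg_le {0} d n (\<lambda>v. W ((c v)(e := b v + vertex_ind S v)))"
      by (rule deg_le_eqI) (use Qadd add in auto)
    moreover have "deg_le {0} (wt e) n (\<lambda>v. real_of_int (b v) + real_of_int (vertex_ind S v))"
      using add by (intro deg_le_add deg_le_vertex_ind) (auto simp: P_def)
    ultimately show ?case by (simp add: P_def)
  next
    case (diff b S)
    \<comment> \<open>A downward step is an upward step read backwards: \<open>Q\<close> is taken at
      the lower point, which must first be shown to form a cube.\<close>
    have b: "deg_le {0} (wt e) n (\<lambda>v. real_of_int (b v - vertex_ind S v))"
      using diff deg_le_diff[OF _ _ deg_le_vertex_ind, of "wt e" n "\<lambda>v. real_of_int (b v)" S]
      by (auto simp: P_def)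
    then have "lattice_cube (insert e E) wt n (\<lambda>v. (c v)(e := b v - vertex_ind S v))"
      by (intro lattice_cube_upd c) auto
    then have "deg_le {0} d n (\<lambda>v. W ((c v)(e := b v)) - vmono S v * Q ((c v)(e := b v - vertex_ind S v)))"
      using diff by (intro deg_le_diff degQ) (auto simp: P_def)
    then have "deg_le {0} d n (\<lambda>v. W ((c v)(e := b v - vertex_ind S v)))"
    proof (rule deg_le_eqI)
      fix v assume "v \<in> dcube n"
      then show "W ((c v)(e := b v - vertex_ind S v)) =
          W ((c v)(e := b v)) - vmono S v * Q ((c v)(e := b v - vertex_ind S v))"
        using Qadd[of v S "c v" "b v - vertex_ind S v"] diff by simp
    qed
    with b show ?case by (simp add: P_def)
  next
    case (cong b b')
    have "deg_le {0} (wt e) n (\<lambda>v. real_of_int (b' v))"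
      by (rule deg_le_eqI[of _ _ _ "\<lambda>v. real_of_int (b v)"]) (use cong in \<open>auto simp: P_def\<close>)
    moreover have "deg_le {0} d n (\<lambda>v. W ((c v)(e := b' v)))"
      by (rule deg_le_eqI[of _ _ _ "\<lambda>v. W ((c v)(e := b v))"]) (use cong in \<open>auto simp: P_def\<close>)
    ultimately show ?case by (simp add: P_def)
  qed
  then show "deg_le {0} d n (\<lambda>v. W (c v))"
    by (simp add: P_def)
qed

text \<open>The lift starts from \<open>V\<close> on the slice where coordinate \<open>e\<close> is
  0 and sums the lifted increments \<open>Q\<close> along \<open>e\<close>; modulo \<int> it then
  obeys the same recursion as \<open>w\<close>.\<close>

lemma lattice_lift_step:
  assumes e: "e \<notin> E" and w: "lattice_morphism \<int> (insert e E) wt d w"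
    and V: "lattice_morphism {0} E wt d V"
      "\<And>m. (\<And>e'. e' \<notin> E \<Longrightarrow> m e' = 0) \<Longrightarrow> V m - w m \<in> \<int>"
    and degQ: "\<And>n c S. lattice_cube (insert e E) wt n c \<Longrightarrow> S \<subseteq> {..<n} \<Longrightarrow> card S \<le> wt e
       \<Longrightarrow> deg_le {0} d n (\<lambda>v. vmono S v * Q (c v))"
    and Q: "\<And>m. (\<And>e'. e' \<notin> insert e E \<Longrightarrow> m e' = 0) \<Longrightarrow> Q m - (w (m(e := m e + 1)) - w m) \<in> \<int>"
  shows "\<exists>W. lattice_morphism {0} (insert e E) wt d W \<and>
    (\<forall>m. (\<forall>e'. e' \<notin> insert e E \<longrightarrow> m e' = 0) \<longrightarrow> W m - w m \<in> \<int>)"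
proof (intro exI conjI allI impI)
  define W where "W m = V (m(e := 0)) + int_sum (\<lambda>t. Q (m(e := t))) (m e)" for m
  have WQ: "W (m(e := m e + 1)) = W m + Q m" for m
    by (simp add: W_def int_sum_step)
  show "lattice_morphism {0} (insert e E) wt d W"
  proof (rule lattice_morphism_integrate[where Q = Q, OF e])
    show "lattice_morphism {0} E wt d (\<lambda>m. W (m(e := 0)))"
      unfolding lattice_morphism_def
    proof (intro allI impI)
      fix n c assume c: "lattice_cube E wt n c"
      then have "deg_le {0} d n (\<lambda>v. V (c v))"
        using V(1) by (auto simp: lattice_morphism_def)
      then show "deg_le {0} d n (\<lambda>v. W ((c v)(e := 0)))"
      proof (rule deg_le_eqI)
        fix v assume "v \<in> dcube n"
        then have "(c v)(e := 0) = c v"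
          using c e by (auto simp: lattice_cube_def fun_eq_iff)
        moreover from this have "c v e = 0" by (metis fun_upd_same)
        ultimately show "W ((c v)(e := 0)) = V (c v)" by (simp add: W_def)
      qed
    qed
  qed (simp_all add: WQ degQ)
  fix m assume m: "\<forall>e'. e' \<notin> insert e E \<longrightarrow> m e' = (0::int)"
  \<comment> \<open>The defect of the lift on the line through \<open>m\<close> in direction
    \<open>e\<close>: an integer at 0 by \<open>V\<close>, with integer increments by
    \<open>Q\<close>.\<close>
  define h where "h t = W (m(e := t)) - w (m(e := t))" for t
  have h_step: "h (t + 1) = h t + (Q (m(e := t)) - (w (m(e := t + 1)) - w (m(e := t))))"
    and h_Q: "Q (m(e := t)) - (w (m(e := t + 1)) - w (m(e := t))) \<in> \<int>" for t
    using WQ[of "m(e := t)"] Q[of "m(e := t)"] m by (simp_all add: h_def)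
  have "h t \<in> \<int>" for t
  proof (induction t rule: int_induct[of _ 0])
    case base
    have "V (m(e := 0)) - w (m(e := 0)) \<in> \<int>"
      using m by (intro V(2)) auto
    then show ?case by (simp add: h_def W_def)
  next
    case (step1 t)
    then show ?case using h_Q[of t] by (simp only: h_step Ints_add)
  next
    case (step2 t)
    then show ?case using Ints_diff[OF step2(2) h_Q[of "t - 1"]] h_step[of "t - 1"] by simp
  qed
  from this[of "m e"] show "W m - w m \<in> \<int>" by (simp add: h_def)
qed

text \<open>Two nested inductions, on \<open>E\<close> and on \<open>d\<close>: the increment in
  direction \<open>e\<close> still depends on all of \<open>insert e E\<close>, so only the degree
  decreases, and it does so because weights are positive.\<close>

lemma lattice_lift:
  assumes "finite E" and "\<And>e. e \<in> E \<Longrightarrow> 0 < wt e" and "lattice_morphism \<int> E wt d w"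
  shows "\<exists>W. lattice_morphism {0} E wt d W \<and> (\<forall>m. (\<forall>e. e \<notin> E \<longrightarrow> m e = 0) \<longrightarrow> W m - w m \<in> \<int>)"
  using assms
proof (induction E arbitrary: d w rule: finite_induct)
  case empty
  show ?case
  proof (intro exI conjI allI impI)
    show "lattice_morphism {0} {} wt d (\<lambda>_. w (\<lambda>_. 0))"
      by (simp add: lattice_morphism_def deg_le_const)
    fix m :: "'a \<Rightarrow> int" assume "\<forall>e. e \<notin> {} \<longrightarrow> m e = 0"
    then have "m = (\<lambda>_. 0)" by auto
    then show "w (\<lambda>_. 0) - w m \<in> \<int>" by simp
  qed
next
  case (insert e E)
  note IH = insert.IH
  have wt: "0 < wt e'" if "e' \<in> insert e E" for e'
    using that insert.prems(1) by blast
  show ?case using insert.prems(2)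
  proof (induction d arbitrary: w rule: less_induct)
    case (less d)
    note w = less.prems
    have "lattice_morphism \<int> E wt d w"
      unfolding lattice_morphism_def
    proof (intro allI impI)
      fix n c assume "lattice_cube E wt n c"
      then have "lattice_cube (insert e E) wt n c"
        using \<open>e \<notin> E\<close> unfolding lattice_cube_def
        by (auto intro: deg_le_eqI[OF deg_le_const[OF add_subgroup_zero, of _ _ 0]])
      then show "deg_le \<int> d n (\<lambda>v. w (c v))"
        using w by (auto simp: lattice_morphism_def)
    qed
    with IH[of d w] wt obtain V where V: "lattice_morphism {0} E wt d V"
      "\<And>m. (\<And>e'. e' \<notin> E \<Longrightarrow> m e' = 0) \<Longrightarrow> V m - w m \<in> \<int>" by blast
    show ?case
    proof (cases "d < wt e")
      case False
      then have "lattice_morphism \<int> (insert e E) wt (d - wt e) (\<lambda>m. w (m(e := m e + 1)) - w m)"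
        by (intro lattice_morphism_diff w) auto
      moreover have "d - wt e < d" using False wt[of e] by auto
      ultimately obtain Q where Q: "lattice_morphism {0} (insert e E) wt (d - wt e) Q"
        "\<And>m. (\<And>e'. e' \<notin> insert e E \<Longrightarrow> m e' = 0) \<Longrightarrow> Q m - (w (m(e := m e + 1)) - w m) \<in> \<int>"
        using less.IH[of "d - wt e"] by blast
      show ?thesis
      proof (rule lattice_lift_step[where Q = Q and V = V and w = w and E = E and e = e])
        fix n c S assume "lattice_cube (insert e E) wt n c" and S: "S \<subseteq> {..<n}" "card S \<le> wt e"
        then have "deg_le {0} (d - wt e + card S) n (\<lambda>v. vmono S v * Q (c v))"
          using Q(1) by (intro deg_le_vmono_mult) (auto simp: lattice_morphism_def)
        then show "deg_le {0} d n (\<lambda>v. vmono S v * Q (c v))"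
          by (rule deg_le_mono[OF add_subgroup_zero]) (use S False in simp)
      qed (use Q(2) w V \<open>e \<notin> E\<close> in blast)+
    next
      case True
      \<comment> \<open>Here \<open>w\<close> is already periodic modulo \<int> in direction
        \<open>e\<close>, so its increments are lifted by 0 and the lift is constant in that
        direction.\<close>
      show ?thesis
      proof (rule lattice_lift_step[where Q = "\<lambda>_. 0" and V = V and w = w and E = E and e = e])
        fix m :: "'a \<Rightarrow> int" assume "\<And>e'. e' \<notin> insert e E \<Longrightarrow> m e' = 0"
        then have "w (m(e := m e + 1)) - w m \<in> \<int>"
          by (intro lattice_morphism_diff_high[OF add_subgroup_Ints w _ True]) auto
        then show "0 - (w (m(e := m e + 1)) - w m) \<in> \<int>"
          using minus_in_Ints_iff[of "w (m(e := m e + 1)) - w m"] by simp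
      qed (simp_all add: deg_le_const w V \<open>e \<notin> E\<close>)
    qed
  qed
qed

section \<open>Continuous lifts along a contraction\<close>

text \<open>A map to \<real>/\<int> is given by a real representative that may jump by integers; its
  continuity is therefore stated for \<open>cis (2 * pi * w x)\<close>.\<close>

lemma cis_2pi_eq_iff: "cis (2 * pi * x) = cis (2 * pi * y) \<longleftrightarrow> x - y \<in> \<int>"
proof -
  have "cis (2 * pi * x) = cis (2 * pi * y) \<longleftrightarrow> (\<exists>n::int. 2 * pi * x = 2 * pi * y + 2 * pi * of_int n)"
    by (subst sin_cos_eq_iff[symmetric]) (auto simp: complex_eq_iff)
  also have "\<dots> \<longleftrightarrow> (\<exists>n::int. x = y + of_int n)"
    by (simp flip: distrib_left)
  also have "\<dots> \<longleftrightarrow> x - y \<in> \<int>"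
    by (auto simp: Ints_def algebra_simps)
  finally show ?thesis .
qed

lemma Ints_valued_continuous_constant:
  fixes f :: "real \<Rightarrow> real"
  assumes f: "continuous_on {0..1} f" "\<And>s. s \<in> {0..1} \<Longrightarrow> f s \<in> \<int>" and s: "s \<in> {0..1}"
  shows "f s = f 0"
proof -
  have "f constant_on {0..1}"
  proof (rule continuous_discrete_range_constant[OF _ f(1)])
    fix x :: real assume x: "x \<in> {0..1}"
    have "1 \<le> norm (f y - f x)" if "y \<in> {0..1}" "f y \<noteq> f x" for y
      using Ints_nonzero_abs_ge1[of "f y - f x"] f(2) x that by auto
    then show "\<exists>e>0. \<forall>y. y \<in> {0..1} \<and> f y \<noteq> f x \<longrightarrow> e \<le> norm (f y - f x)"
      by (intro exI[of _ 1]) auto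
  qed simp
  then show ?thesis
    using s by (auto simp: constant_on_def)
qed

text \<open>The lift is the imaginary part of a continuous logarithm, which exists because the
  interval is contractible. Starting at 0 makes it unique.\<close>

lemma path_lift_mod_Ints:
  fixes u :: "real \<Rightarrow> real"
  assumes "continuous_on {0..1} (\<lambda>s. cis (2 * pi * u s))"
  obtains p where "continuous_on {0..1} p" "p 0 = 0"
    "\<And>s. s \<in> {0..1} \<Longrightarrow> p s - (u s - u 0) \<in> \<int>"
proof -
  obtain g where g: "continuous_on {0..1} g" "\<And>s. s \<in> {0..1} \<Longrightarrow> cis (2 * pi * u s) = exp (g s)"
    using continuous_logarithm_on_contractible[OF assms, of thesis] convex_imp_contractible[of "{0..1::real}"]
    by (auto simp: cis_neq_zero)
  define q where "q s = Im (g s) / (2 * pi)" for s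
  have q: "q s - u s \<in> \<int>" if "s \<in> {0..1}" for s
  proof -
    have "norm (exp (g s)) = 1" using g(2)[OF that] by (metis norm_cis)
    then have "exp (Re (g s)) = 1" by (simp only: norm_exp_eq_Re)
    then have "exp (g s) = cis (Im (g s))" by (simp add: exp_eq_polar)
    then have "cis (2 * pi * q s) = cis (2 * pi * u s)" using g(2)[OF that] by (simp add: q_def)
    then show ?thesis by (simp add: cis_2pi_eq_iff)
  qed
  show thesis
  proof
    show "continuous_on {0..1} (\<lambda>s. q s - q 0)"
      unfolding q_def by (intro continuous_intros g) auto
    fix s :: real assume "s \<in> {0..1}"
    from Ints_diff[OF q[OF this] q[of 0]] show "(q s - q 0) - (u s - u 0) \<in> \<int>"
      by (simp add: algebra_simps)
  qed simp
qed

lemma continuous_map_path_const: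
  assumes "x \<in> topspace X"
  shows "continuous_map (top_of_set S) (prod_topology (top_of_set S) X) (\<lambda>s. (s, x))"
  using assms by (intro continuous_map_pairedI) auto

text \<open>Homotopy lifting along \<sigma>: the lift at \<open>x\<close> is \<open>V x\<close> plus
  the endpoint of the lifted path \<open>s \<mapsto> w (\<sigma> s x)\<close> started at 0. The
  point at issue is the continuity of this endpoint in \<open>x\<close>.\<close>

lemma topological_lift:
  fixes \<sigma> :: "real \<Rightarrow> 'a \<Rightarrow> 'a" and w V :: "'a \<Rightarrow> real"
  assumes \<sigma>: "continuous_map (prod_topology (top_of_set {0..1}) X) X (\<lambda>(s, x). \<sigma> s x)"
    and \<sigma>1: "\<And>x. x \<in> topspace X \<Longrightarrow> \<sigma> 1 x = x"
    and \<sigma>0: "\<And>x s. x \<in> topspace X \<Longrightarrow> s \<in> {0..1} \<Longrightarrow> \<sigma> s (\<sigma> 0 x) = \<sigma> 0 x"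
    and w: "continuous_map X euclidean (\<lambda>x. cis (2 * pi * w x))"
    and V: "continuous_map X euclideanreal V" "\<And>x. x \<in> topspace X \<Longrightarrow> V x - w (\<sigma> 0 x) \<in> \<int>"
  obtains W where "continuous_map X euclideanreal W"
    "\<And>x. x \<in> topspace X \<Longrightarrow> W x - w x \<in> \<int>"
    "\<And>x. x \<in> topspace X \<Longrightarrow> W (\<sigma> 0 x) = V (\<sigma> 0 x)"
proof -
  define I where "I = {0..1::real}"
  have mem: "\<sigma> s x \<in> topspace X" if "s \<in> I" "x \<in> topspace X" for s x
    using continuous_map_funspace[OF \<sigma>] that by (force simp: I_def)
  have w\<sigma>: "continuous_map (prod_topology (top_of_set I) X) euclidean (\<lambda>(s, x). cis (2 * pi * w (\<sigma> s x)))"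
    using continuous_map_compose[OF \<sigma> w] by (simp add: o_def case_prod_unfold I_def)
  have path: "continuous_on I (\<lambda>s. cis (2 * pi * w (\<sigma> s x)))" if "x \<in> topspace X" for x
    using continuous_map_compose[OF continuous_map_path_const[OF that] w\<sigma>] by (simp add: o_def)
  have "\<exists>p. continuous_on I p \<and> p 0 = 0 \<and> (\<forall>s\<in>I. p s - (w (\<sigma> s x) - w (\<sigma> 0 x)) \<in> \<int>)"
    if "x \<in> topspace X" for x
    using path_lift_mod_Ints[of "\<lambda>s. w (\<sigma> s x)"] path[OF that] unfolding I_def by metis
  then obtain P where P: "\<And>x. x \<in> topspace X \<Longrightarrow> continuous_on I (P x)"
      "\<And>x. x \<in> topspace X \<Longrightarrow> P x 0 = 0"
      "\<And>x s. x \<in> topspace X \<Longrightarrow> s \<in> I \<Longrightarrow> P x s - (w (\<sigma> s x) - w (\<sigma> 0 x)) \<in> \<int>"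
    by metis
  \<comment> \<open>Two lifts of one path with the same start differ by a continuous integer-valued
    function, which is constant.\<close>
  have uniq: "q s = P x s" if "continuous_on I q" "q 0 = 0"
    "\<And>s. s \<in> I \<Longrightarrow> q s - (w (\<sigma> s x) - w (\<sigma> 0 x)) \<in> \<int>" "x \<in> topspace X" "s \<in> I" for q x s
  proof -
    have "q t - P x t \<in> \<int>" if "t \<in> I" for t
      using Ints_diff[OF \<open>\<And>s. s \<in> I \<Longrightarrow> q s - (w (\<sigma> s x) - w (\<sigma> 0 x)) \<in> \<int>\<close>[OF that] P(3)[OF \<open>x \<in> topspace X\<close> that]]
      by simp
    then have "q s - P x s = q 0 - P x 0"
      using that P(1) unfolding I_def
      by (intro Ints_valued_continuous_constant continuous_on_diff) auto
    then show ?thesis using that P(2) by simp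
  qed
  have cL: "continuous_map X euclideanreal (\<lambda>x. P x 1)"
    unfolding Met_TC.continuous_map_to_metric[of X "\<lambda>x. P x 1", simplified]
  proof (intro ballI allI impI)
    fix x and \<epsilon> :: real assume x: "x \<in> topspace X" and \<epsilon>: "0 < \<epsilon>"
    \<comment> \<open>On \<open>N\<close> the principal argument is continuous and below
      \<open>pi * \<epsilon>\<close> in absolute value, so after division by \<open>2 * pi\<close>
      each end of a path contributes less than \<open>\<epsilon> / 2\<close>.\<close>
    define N where "N = {z. 0 < Re z} \<inter> (\<lambda>z. Im (Ln z)) -` {- pi * \<epsilon><..<pi * \<epsilon>}"
    have contLn: "continuous_on {z. 0 < Re z} (\<lambda>z. Im (Ln z))"
      by (intro continuous_intros) (auto simp: complex_nonpos_Reals_iff)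
    have "open N"
      unfolding N_def by (rule continuous_open_preimage[OF contLn]) (auto simp: open_halfspace_Re_gt)
    \<comment> \<open>The ratio of the path of \<open>y\<close> to the path of \<open>x\<close>,
      equal to 1 for \<open>y = x\<close>.\<close>
    define G where "G = (\<lambda>(s, y). cis (2 * pi * w (\<sigma> s y)) * cnj (cis (2 * pi * w (\<sigma> s x))))"
    have "continuous_map (prod_topology (top_of_set I) X) euclidean (\<lambda>z. cis (2 * pi * w (\<sigma> (fst z) x)))"
      using continuous_map_compose[OF continuous_map_fst path[OF x, folded continuous_map_iff_continuous], of X]
      by (simp add: o_def)
    then have G: "continuous_map (prod_topology (top_of_set I) X) euclidean G"
      using w\<sigma> unfolding G_def case_prod_unfold continuous_map_atin limitin_canonical_iff
      by (intro ballI tendsto_mult tendsto_cnj; blast)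
    have Geq: "G (s, y) = cis (2 * pi * (w (\<sigma> s y) - w (\<sigma> s x)))" for s y
      by (simp add: G_def cis_cnj cis_mult algebra_simps)
    define D where "D = {z \<in> topspace (prod_topology (top_of_set I) X). G z \<in> N}"
    have op: "openin (prod_topology (top_of_set I) X) D"
      unfolding D_def using \<open>open N\<close> by (intro openin_continuous_map_preimage[OF G]) auto
    have sub: "I \<times> {x} \<subseteq> D"
      using x \<epsilon> by (auto simp: D_def Geq N_def)
    \<comment> \<open>Compactness of the interval gives one neighbourhood of \<open>x\<close> on
      which the ratio stays in \<open>N\<close> for all \<open>s\<close> at once.\<close>
    have "compactin (top_of_set I) I"
      by (simp add: compactin_subtopology I_def)
    from tube_lemma_left[OF op this x sub] obtain U U' where U: "openin X U" "I \<subseteq> U'" "x \<in> U"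
        "U' \<times> U \<subseteq> D"
      by blast
    have "\<bar>P y 1 - P x 1\<bar> < \<epsilon>" if "y \<in> U" for y
    proof -
      have y: "y \<in> topspace X" using U(1) that openin_subset by blast
      have GN: "G (s, y) \<in> N" if "s \<in> I" for s using U that \<open>y \<in> U\<close> by (auto simp: D_def)
      define g where "g s = Im (Ln (G (s, y))) / (2 * pi)" for s
      have "continuous_on I (\<lambda>s. G (s, y))"
        using continuous_map_compose[OF continuous_map_path_const[OF y] G] by (simp add: o_def)
      then have "continuous_on I (\<lambda>s. Im (Ln (G (s, y))))"
        by (rule continuous_on_compose2[OF contLn]) (use GN in \<open>auto simp: N_def\<close>)
      then have cg: "continuous_on I g"
        unfolding g_def by (intro continuous_on_divide continuous_on_const) auto
      have gI: "g s - (w (\<sigma> s y) - w (\<sigma> s x)) \<in> \<int>" if "s \<in> I" for s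
      proof -
        have "norm (G (s, y)) = 1" "G (s, y) \<noteq> 0" by (auto simp: Geq)
        then have "G (s, y) = cis (Im (Ln (G (s, y))))"
          by (metis Arg_def cis_Arg sgn_div_norm scaleR_one inverse_1)
        then have "cis (2 * pi * g s) = cis (2 * pi * (w (\<sigma> s y) - w (\<sigma> s x)))"
          by (simp add: g_def Geq)
        then show ?thesis by (simp only: cis_2pi_eq_iff)
      qed
      have g_small: "\<bar>g s\<bar> < \<epsilon> / 2" if "s \<in> I" for s
        using GN[OF that] by (auto simp: N_def g_def field_simps abs_less_iff)
      have I01: "0 \<in> I" "1 \<in> I" by (auto simp: I_def)
      \<comment> \<open>The lifted path of \<open>x\<close>, corrected by the small logarithm of the
        ratio, is the lift of the path of \<open>y\<close>.\<close>
      have "P x 1 + g 1 - g 0 = P y 1"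
      proof (rule uniq[where q = "\<lambda>s. P x s + g s - g 0"])
        show "continuous_on I (\<lambda>s. P x s + g s - g 0)"
          by (intro continuous_intros cg P x)
        fix s assume s: "s \<in> I"
        from Ints_diff[OF Ints_add[OF P(3)[OF x s] gI[OF s]] gI[OF I01(1)]]
        show "P x s + g s - g 0 - (w (\<sigma> s y) - w (\<sigma> 0 y)) \<in> \<int>" by (simp add: algebra_simps)
      qed (use P(2) x y I01 in auto)
      then show ?thesis using g_small[OF I01(1)] g_small[OF I01(2)] by linarith
    qed
    then show "\<exists>U. openin X U \<and> x \<in> U \<and> (\<forall>y\<in>U. dist (P x 1) (P y 1) < \<epsilon>)"
      using U(1,3) by (auto simp: dist_real_def abs_minus_commute)
  qed
  show thesis
  proof
    show "continuous_map X euclideanreal (\<lambda>x. V x + P x 1)"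
      using V(1) cL by (intro continuous_map_add) auto
    fix x assume x: "x \<in> topspace X"
    have I01: "0 \<in> I" "1 \<in> I" by (auto simp: I_def)
    from Ints_add[OF V(2)[OF x] P(3)[OF x I01(2)]] show "V x + P x 1 - w x \<in> \<int>"
      using \<sigma>1[OF x] by (simp add: algebra_simps)
    \<comment> \<open>The path through \<open>\<sigma> 0 x\<close> is constant, so its lift is
      0.\<close>
    have "0 = P (\<sigma> 0 x) 1"
      by (rule uniq[where q = "\<lambda>_. 0"]) (use \<sigma>0 mem x I01 in \<open>auto simp: I_def\<close>)
    then show "V (\<sigma> 0 x) + P (\<sigma> 0 x) 1 = V (\<sigma> 0 x)" by simp
  qed
qed

section \<open>Separating characters\<close>

text \<open>Each \<open>\<xi> j\<close> represents a homomorphism to \<open>\<real> / K\<close>, and together they are injective.\<close>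

locale character_system = comm_group G for G :: "'a monoid" (structure) +
  fixes K :: "real set" and J :: "'j set" and \<xi> :: "'j \<Rightarrow> 'a \<Rightarrow> real"
  assumes K: "add_subgroup K"
    and mult_char: "\<And>j x y. j \<in> J \<Longrightarrow> x \<in> carrier G \<Longrightarrow> y \<in> carrier G
      \<Longrightarrow> \<xi> j (x \<otimes> y) - (\<xi> j x + \<xi> j y) \<in> K"
    and separates: "\<And>x. x \<in> carrier G \<Longrightarrow> (\<And>j. j \<in> J \<Longrightarrow> \<xi> j x \<in> K) \<Longrightarrow> x = \<one>"
begin

lemma one_char: "j \<in> J \<Longrightarrow> \<xi> j \<one> \<in> K"
  using mult_char[of j \<one> \<one>] subgroup_minus_iff[OF K] by simp

lemma inv_char:
  assumes "j \<in> J" "x \<in> carrier G" shows "\<xi> j (inv x) + \<xi> j x \<in> K"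
  using subgroup_diff[OF K one_char[OF assms(1)] mult_char[of j "inv x" x]] assms by simp

lemma sign_pow_char:
  assumes "j \<in> J" "x \<in> carrier G"
  shows "\<xi> j (x [^] ((-1) ^ m :: int)) - (-1) ^ m * \<xi> j x \<in> K"
proof (cases "even m")
  case True then show ?thesis using assms subgroup_0[OF K] by (simp add: int_pow_1)
next
  case False
  then have "x [^] ((-1) ^ m :: int) = inv x"
    using assms int_pow_neg[of x 1] by (simp add: int_pow_1)
  then show ?thesis using False inv_char[OF assms] by simp
qed

lemma finprod_char:
  assumes "j \<in> J" "finite S" "f \<in> S \<rightarrow> carrier G"
  shows "\<xi> j (finprod G f S) - (\<Sum>s\<in>S. \<xi> j (f s)) \<in> K"
  using assms(2,3)
proof (induction S rule: finite_induct)
  case empty then show ?case using one_char[OF assms(1)] by simp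
next
  case (insert s S)
  have "\<xi> j (f s \<otimes> finprod G f S) - (\<xi> j (f s) + \<xi> j (finprod G f S)) \<in> K"
    using insert.prems by (intro mult_char assms(1) finprod_closed) auto
  from subgroup_add[OF K this insert.IH] show ?case
    using insert by (simp add: algebra_simps)
qed

lemma char_eqI:
  assumes "x \<in> carrier G" "y \<in> carrier G" "\<And>j. j \<in> J \<Longrightarrow> \<xi> j x - \<xi> j y \<in> K"
  shows "x = y"
proof -
  have "\<xi> j (x \<otimes> inv y) \<in> K" if j: "j \<in> J" for j
    using subgroup_add[OF K subgroup_diff[OF K subgroup_add[OF K mult_char[of j x "inv y"] inv_char[OF j assms(2)]]
          subgroup_0[OF K]] assms(3)[OF j]] j assms(1,2)
    by (simp add: algebra_simps)
  then have "x \<otimes> inv y = \<one>"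
    using assms by (intro separates) auto
  then show ?thesis
    using assms by (metis inv_equality inv_inv inv_closed)
qed

text \<open>The bridge from groups to real functions: characters are additive modulo
  \<open>K\<close> and jointly injective, so the alternating product is trivial exactly when the
  alternating sum of every character lies in \<open>K\<close>.\<close>

lemma cubes_Dnil_iff:
  "c \<in> cubes (\<D> k G T) n \<longleftrightarrow>
    c \<in> dcube n \<rightarrow>\<^sub>E carrier G \<and> (\<forall>j\<in>J. deg_le K k n (\<lambda>v. \<xi> j (c v)))"
proof -
  have "((\<Otimes>v\<in>dcube (k + 1). c (\<phi> v) [^] ((-1) ^ dcube_weight (k + 1) v :: int)) = \<one>) \<longleftrightarrow>
      (\<forall>j\<in>J. altsum (k + 1) (\<lambda>v. \<xi> j (c (\<phi> v))) \<in> K)" (is "?p = \<one> \<longleftrightarrow> _")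
    if c: "c \<in> dcube n \<rightarrow>\<^sub>E carrier G" and \<phi>: "\<phi> \<in> dcube_morphism (k + 1) n" for \<phi>
  proof -
    have mem: "c (\<phi> v) \<in> carrier G" if "v \<in> dcube (k + 1)" for v
      using c dcube_morphism_app[OF \<phi> that] by auto
    have p: "?p \<in> carrier G"
      using mem by (intro finprod_closed) auto
    have "\<xi> j ?p - altsum (k + 1) (\<lambda>v. \<xi> j (c (\<phi> v))) \<in> K" if j: "j \<in> J" for j
    proof -
      have "\<xi> j ?p - (\<Sum>v\<in>dcube (k + 1). \<xi> j (c (\<phi> v) [^] ((-1) ^ dcube_weight (k + 1) v :: int))) \<in> K"
        using mem by (intro finprod_char j finite_dcube) auto
      moreover have "(\<Sum>v\<in>dcube (k + 1). \<xi> j (c (\<phi> v) [^] ((-1) ^ dcube_weight (k + 1) v :: int))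
          - (-1) ^ dcube_weight (k + 1) v * \<xi> j (c (\<phi> v))) \<in> K"
        using mem by (intro subgroup_sum[OF K] sign_pow_char j)
      ultimately show ?thesis
        using subgroup_add[OF K] unfolding altsum_def sum_subtractf by fastforce
    qed
    then have "\<xi> j ?p \<in> K \<longleftrightarrow> altsum (k + 1) (\<lambda>v. \<xi> j (c (\<phi> v))) \<in> K" if "j \<in> J" for j
      using that by (intro subgroup_cong[OF K])
    then show ?thesis
      using separates[OF p] one_char by auto
  qed
  then show ?thesis
    by (auto simp: Dnil_def deg_le_def)
qed

end

section \<open>Characters of the covering group and of the compact group\<close>

lemma comm_group_DirProd:
  assumes "comm_group G" "comm_group H" shows "comm_group (G \<times>\<times> H)"
proof -
  interpret G: comm_group G by fact
  interpret H: comm_group H by fact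
  show ?thesis
    by (rule group.group_comm_groupI[OF DirProd_group])
      (auto simp: G.is_group H.is_group G.m_comm H.m_comm)
qed

lemma comm_group_product_group:
  assumes "\<And>i. i \<in> I \<Longrightarrow> comm_group (G i)" shows "comm_group (product_group I G)"
proof (rule group.group_comm_groupI)
  show "group (product_group I G)"
    using assms by (simp add: comm_group.axioms(2))
  fix x y assume xy: "x \<in> carrier (product_group I G)" "y \<in> carrier (product_group I G)"
  have "x i \<otimes>\<^bsub>G i\<^esub> y i = y i \<otimes>\<^bsub>G i\<^esub> x i" if i: "i \<in> I" for i
  proof -
    interpret comm_group "G i" using assms i .
    show ?thesis using xy i by (intro m_comm) auto
  qed
  then show "x \<otimes>\<^bsub>product_group I G\<^esub> y = y \<otimes>\<^bsub>product_group I G\<^esub> x"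
    by (auto intro: restrict_ext)
qed

lemma comm_group_real_group: "comm_group real_group"
proof (rule comm_groupI)
  fix x show "\<exists>y\<in>carrier real_group. y \<otimes>\<^bsub>real_group\<^esub> x = \<one>\<^bsub>real_group\<^esub>"
    by (intro bexI[of _ "- x"]) (auto simp: real_group_def)
qed (auto simp: real_group_def)

definition ZR_coord :: "nat + nat \<Rightarrow> (nat \<Rightarrow> int) \<times> (nat \<Rightarrow> real) \<Rightarrow> real" where
  "ZR_coord j x = (case j of Inl l \<Rightarrow> real_of_int (fst x l) | Inr l \<Rightarrow> snd x l)"

text \<open>\<open>g\<close> will be the inverse of the isomorphism \<open>h\<close>, reading an
  element of \<open>Z\<close> as a tuple of residues.\<close>

definition ZT_coord ::
    "(nat \<Rightarrow> nat) \<Rightarrow> ('z \<Rightarrow> nat \<Rightarrow> int) \<Rightarrow> nat + nat \<Rightarrow> 'z \<times> (nat \<Rightarrow> real) \<Rightarrow> real" where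
  "ZT_coord n g j x = (case j of Inl l \<Rightarrow> real_of_int (g (fst x) l) / real (n l) | Inr l \<Rightarrow> snd x l)"

lemma carrier_ZR_group: "carrier (ZR_group a b) = ({..<a} \<rightarrow>\<^sub>E UNIV) \<times> ({..<b} \<rightarrow>\<^sub>E UNIV)"
  by (simp add: ZR_group_def integer_group_def real_group_def)

lemma ZR_coord_one: "j \<in> {..<a} <+> {..<b} \<Longrightarrow> ZR_coord j \<one>\<^bsub>ZR_group a b\<^esub> = 0"
  by (auto simp: ZR_coord_def ZR_group_def integer_group_def real_group_def)

lemma ZR_coord_mult:
  "j \<in> {..<a} <+> {..<b} \<Longrightarrow> ZR_coord j (x \<otimes>\<^bsub>ZR_group a b\<^esub> y) = ZR_coord j x + ZR_coord j y"
  by (auto simp: ZR_coord_def ZR_group_def mult_DirProd' integer_group_def real_group_def)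

lemma ZR_eqI:
  assumes x: "x \<in> carrier (ZR_group a b)" and y: "y \<in> carrier (ZR_group a b)"
    and eq: "\<And>j. j \<in> {..<a} <+> {..<b} \<Longrightarrow> ZR_coord j x = ZR_coord j y"
  shows "x = y"
proof (rule prod_eqI)
  have "fst x l = fst y l" if "l < a" for l
    using eq[OF InlI, of l] that by (simp add: ZR_coord_def)
  then show "fst x = fst y"
    using x y by (intro extensionalityI[of _ "{..<a}"]) (auto simp: carrier_ZR_group PiE_iff)
  have "snd x l = snd y l" if "l < b" for l
    using eq[OF InrI, of l] that by (simp add: ZR_coord_def)
  then show "snd x = snd y"
    using x y by (intro extensionalityI[of _ "{..<b}"]) (auto simp: carrier_ZR_group PiE_iff)
qed

lemma comm_group_ZR_group: "comm_group (ZR_group a b)"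
  unfolding ZR_group_def
  by (intro comm_group_DirProd comm_group_product_group abelian_integer_group comm_group_real_group)

lemma character_system_ZR: "character_system (ZR_group a b) {0} ({..<a} <+> {..<b}) ZR_coord"
proof -
  interpret comm_group "ZR_group a b" by (rule comm_group_ZR_group)
  show ?thesis
  proof
    fix x assume x: "x \<in> carrier (ZR_group a b)"
      and 0: "\<And>j. j \<in> {..<a} <+> {..<b} \<Longrightarrow> ZR_coord j x \<in> {0}"
    show "x = \<one>\<^bsub>ZR_group a b\<^esub>"
    proof (rule ZR_eqI[OF x one_closed])
      fix j assume j: "j \<in> {..<a} <+> {..<b}"
      show "ZR_coord j x = ZR_coord j \<one>\<^bsub>ZR_group a b\<^esub>"
        using 0[OF j] ZR_coord_one[OF j] by simp
    qed
  qed (auto simp: ZR_coord_mult)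
qed

lemma frac_diff_Ints: "frac x - x \<in> \<int>" for x :: real
  by (simp add: frac_def)

lemma int_mod_div_diff_Ints:
  "0 < m \<Longrightarrow> real_of_int (t mod int m) / real m - real_of_int t / real m \<in> \<int>"
proof -
  assume m: "0 < m"
  have "real_of_int t = real_of_int (t mod int m) + real m * real_of_int (t div int m)"
    by (metis mod_mult_div_eq of_int_add of_int_mult of_int_of_nat_eq)
  then have "real_of_int (t mod int m) / real m - real_of_int t / real m = - real_of_int (t div int m)"
    using m by (simp add: field_simps)
  then show ?thesis by simp
qed

lemma comm_group_ZT_group: "comm_group Z \<Longrightarrow> comm_group (ZT_group Z s)"
  unfolding ZT_group_def
  by (intro comm_group_DirProd comm_group_product_group comm_group_circle_group)

lemma character_system_ZT:
  assumes Z: "comm_group Z" and n: "\<And>j. j < r \<Longrightarrow> 0 < n j" and g: "g \<in> iso Z (cyclic_product r n)"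
  shows "character_system (ZT_group Z s) \<int> ({..<r} <+> {..<s}) (ZT_coord n g)"
proof -
  interpret comm_group "ZT_group Z s" by (rule comm_group_ZT_group[OF Z])
  interpret Z: comm_group Z by (rule Z)
  have g_hom: "g \<in> hom Z (cyclic_product r n)" and g_inj: "inj_on g (carrier Z)"
    using g by (auto simp: iso_def bij_betw_def)
  have g_range: "g z l \<in> {0..<int (n l)}" if "z \<in> carrier Z" "l < r" for z l
    using hom_in_carrier[OF g_hom that(1)] n[OF that(2)] that(2)
    by (force simp: carrier_integer_mod_group dest: PiE_mem)
  show ?thesis
  proof
    fix j x y assume j: "j \<in> {..<r} <+> {..<s}"
      and x: "x \<in> carrier (ZT_group Z s)" and y: "y \<in> carrier (ZT_group Z s)"
    show "ZT_coord n g j (x \<otimes>\<^bsub>ZT_group Z s\<^esub> y) - (ZT_coord n g j x + ZT_coord n g j y) \<in> \<int>"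
    proof (cases j)
      case (Inl l)
      then have l: "l < r" using j by auto
      have "g (fst x \<otimes>\<^bsub>Z\<^esub> fst y) l = (g (fst x) l + g (fst y) l) mod int (n l)"
      proof -
        have "fst x \<in> carrier Z" "fst y \<in> carrier Z"
          using x y by (simp_all add: ZT_group_def mem_Times_iff)
        from hom_mult[OF g_hom this] show ?thesis
          using l by simp
      qed
      then show ?thesis
        using int_mod_div_diff_Ints[OF n[OF l], of "g (fst x) l + g (fst y) l"]
        by (simp add: Inl ZT_coord_def ZT_group_def mult_DirProd' add_divide_distrib)
    next
      case (Inr l)
      then show ?thesis
        using j frac_diff_Ints[of "snd x l + snd y l"]
        by (auto simp: ZT_coord_def ZT_group_def mult_DirProd' circle_group_def)
    qed
  next
    fix x assume x: "x \<in> carrier (ZT_group Z s)"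
      and int: "\<And>j. j \<in> {..<r} <+> {..<s} \<Longrightarrow> ZT_coord n g j x \<in> \<int>"
    show "x = \<one>\<^bsub>ZT_group Z s\<^esub>"
    proof (rule prod_eqI)
      have fz: "fst x \<in> carrier Z" using x by (simp add: ZT_group_def mem_Times_iff)
      have "g (fst x) l = 0" if l: "l < r" for l
      proof -
        have "real_of_int (g (fst x) l) / real (n l) \<in> \<int>"
          using int[OF InlI, of l] l by (simp add: ZT_coord_def)
        then obtain t where "real_of_int (g (fst x) l) / real (n l) = of_int t"
          by (auto elim: Ints_cases)
        then have "real_of_int (g (fst x) l) = real_of_int (t * int (n l))"
          using n[OF l] by (simp add: field_simps)
        then have "g (fst x) l = t * int (n l)" by (simp only: of_int_eq_iff)
        \<comment> \<open>The residue is a multiple of \<open>n l\<close> in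
          \<open>[0, n l)\<close>, hence 0.\<close>
        then have "g (fst x) l mod int (n l) = 0" by simp
        then show ?thesis using g_range[OF fz l] by simp
      qed
      then have "g (fst x) = \<one>\<^bsub>cyclic_product r n\<^esub>"
        using hom_in_carrier[OF g_hom fz]
        by (intro extensionalityI[of _ "{..<r}"]) (auto simp: PiE_iff)
      moreover have "g \<one>\<^bsub>Z\<^esub> = \<one>\<^bsub>cyclic_product r n\<^esub>"
        using hom_one[OF g_hom Z.is_group] by simp
      ultimately show "fst x = fst \<one>\<^bsub>ZT_group Z s\<^esub>"
        using g_inj fz by (simp add: ZT_group_def inj_on_def)
      have sx: "snd x \<in> {..<s} \<rightarrow>\<^sub>E {0..<1}" using x by (simp add: ZT_group_def circle_group_def mem_Times_iff)
      have "snd x l = 0" if l: "l < s" for l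
      proof -
        have "snd x l \<in> \<int>" using int[OF InrI, of l] l by (simp add: ZT_coord_def)
        moreover have "0 \<le> snd x l" "snd x l < 1" using PiE_mem[OF sx, of l] l by simp_all
        ultimately show ?thesis
          using frac_eq[of "snd x l"] frac_eq_0_iff[of "snd x l"] by simp
      qed
      then show "snd x = snd \<one>\<^bsub>ZT_group Z s\<^esub>"
        using sx by (intro extensionalityI[of _ "{..<s}"]) (auto simp: PiE_iff ZT_group_def circle_group_def)
    qed
  qed simp
qed

section \<open>Scalar morphisms on free nilspaces\<close>

abbreviation ZR_index :: "nat \<Rightarrow> nat \<Rightarrow> (nat + nat) set" where
  "ZR_index a b \<equiv> {..<a} <+> {..<b}"

lemma points_Dnil [simp]: "points (\<D> k G T) = topspace T"
  by (simp add: Dnil_def)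

lemma ctop_Dnil [simp]: "ctop (\<D> k G T) = T"
  by (simp add: Dnil_def)

lemma ctop_free_nilspace:
  "ctop (free_nilspace k a b) = product_topology (\<lambda>j. ZR_topology (a j) (b j)) {1..k}"
  by (simp add: free_nilspace_def product_cubespace_def)

lemma points_free_nilspace:
  "points (free_nilspace k a b) = (\<Pi>\<^sub>E j\<in>{1..k}. carrier (ZR_group (a j) (b j)))"
  by (simp add: ctop_free_nilspace topspace_ZR_topology)

lemma free_nilspace_component:
  assumes "f \<in> points (free_nilspace k a b)" "j \<in> {1..k}"
  shows "f j \<in> carrier (ZR_group (a j) (b j))"
  using assms unfolding points_free_nilspace by (rule PiE_mem)

lemma cubes_free_nilspace_iff:
  "c \<in> cubes (free_nilspace k a b) n \<longleftrightarrow>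
    c \<in> dcube n \<rightarrow>\<^sub>E points (free_nilspace k a b) \<and>
    (\<forall>j\<in>{1..k}. \<forall>i\<in>ZR_index (a j) (b j). deg_le {0} j n (\<lambda>v. ZR_coord i (c v j)))"
proof -
  have "(\<lambda>v\<in>dcube n. c v j) \<in> cubes (\<D> j (ZR_group (a j) (b j)) (ZR_topology (a j) (b j))) n \<longleftrightarrow>
      (\<forall>i\<in>ZR_index (a j) (b j). deg_le {0} j n (\<lambda>v. ZR_coord i (c v j)))"
    if c: "c \<in> dcube n \<rightarrow>\<^sub>E points (free_nilspace k a b)" and j: "j \<in> {1..k}" for j
  proof -
    have "c v j \<in> carrier (ZR_group (a j) (b j))" if "v \<in> dcube n" for v
      by (rule free_nilspace_component[OF PiE_mem[OF c that] j])
    moreover have "deg_le {0} j n (\<lambda>v. ZR_coord i ((\<lambda>v\<in>dcube n. c v j) v)) \<longleftrightarrow>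
        deg_le {0} j n (\<lambda>v. ZR_coord i (c v j))" for i
      by (rule deg_le_cong) simp
    ultimately show ?thesis
      by (simp add: character_system.cubes_Dnil_iff[OF character_system_ZR])
  qed
  moreover have "c \<in> cubes (free_nilspace k a b) n \<longleftrightarrow>
    c \<in> dcube n \<rightarrow>\<^sub>E points (free_nilspace k a b) \<and>
    (\<forall>j\<in>{1..k}. (\<lambda>v\<in>dcube n. c v j) \<in> cubes (\<D> j (ZR_group (a j) (b j)) (ZR_topology (a j) (b j))) n)"
    by (simp add: free_nilspace_def product_cubespace_def)
  ultimately show ?thesis by blast
qed

lemma free_nilspace_eqI:
  assumes x: "x \<in> points (free_nilspace k a b)" and y: "y \<in> points (free_nilspace k a b)"
    and eq: "\<And>j i. j \<in> {1..k} \<Longrightarrow> i \<in> ZR_index (a j) (b j) \<Longrightarrow> ZR_coord i (x j) = ZR_coord i (y j)"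
  shows "x = y"
proof (rule PiE_ext[OF x[unfolded points_free_nilspace] y[unfolded points_free_nilspace]])
  fix j assume j: "j \<in> {1..k}"
  show "x j = y j"
  proof (rule ZR_eqI)
    show "x j \<in> carrier (ZR_group (a j) (b j))" "y j \<in> carrier (ZR_group (a j) (b j))"
      using x y j by (blast intro: free_nilspace_component)+
  qed (rule eq[OF j])
qed

text \<open>For \<open>K = {0}\<close> a morphism to the degree-\<open>d\<close> nilspace on
  \<real>; for \<open>K = \<int>\<close> a real representative of one to \<real>/\<int>.\<close>

definition scalar_morphism :: "real set \<Rightarrow> 'a cubespace \<Rightarrow> nat \<Rightarrow> ('a \<Rightarrow> real) \<Rightarrow> bool" where
  "scalar_morphism K X d w \<longleftrightarrow> (\<forall>n. \<forall>c\<in>cubes X n. deg_le K d n (\<lambda>v. w (c v)))"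

context
  fixes k :: nat and a b :: "nat \<Rightarrow> nat"
begin

private abbreviation "F \<equiv> free_nilspace k a b"

text \<open>\<open>(j, l)\<close> names the \<open>l\<close>-th integer coordinate of the
  degree-\<open>j\<close> factor, so \<open>fst\<close> serves as the weight.\<close>

definition lattice_index :: "(nat \<times> nat) set" where
  "lattice_index = (SIGMA j:{1..k}. {..<a j})"

definition lattice_embed :: "(nat \<times> nat \<Rightarrow> int) \<Rightarrow> nat \<Rightarrow> (nat \<Rightarrow> int) \<times> (nat \<Rightarrow> real)" where
  "lattice_embed m = (\<lambda>j\<in>{1..k}. (\<lambda>l\<in>{..<a j}. m (j, l), \<lambda>l\<in>{..<b j}. 0))"

definition lattice_part :: "(nat \<Rightarrow> (nat \<Rightarrow> int) \<times> (nat \<Rightarrow> real)) \<Rightarrow> nat \<times> nat \<Rightarrow> int" where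
  "lattice_part f = (\<lambda>(j, l). if (j, l) \<in> lattice_index then fst (f j) l else 0)"

text \<open>Contracts \<open>F\<close> onto its lattice points. It acts on each factor by a group
  endomorphism, hence preserves cubes; on points of \<open>F\<close> it is the identity at 1 and
  \<open>lattice_embed \<circ> lattice_part\<close> at 0.\<close>

definition real_scale :: "real \<Rightarrow> (nat \<Rightarrow> (nat \<Rightarrow> int) \<times> (nat \<Rightarrow> real)) \<Rightarrow> nat \<Rightarrow> (nat \<Rightarrow> int) \<times> (nat \<Rightarrow> real)" where
  "real_scale s f = (\<lambda>j\<in>{1..k}. (fst (f j), \<lambda>l\<in>{..<b j}. s * snd (f j) l))"

lemma lattice_embed_points: "lattice_embed m \<in> points F"
  by (auto simp: points_free_nilspace carrier_ZR_group lattice_embed_def)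

lemma real_scale_points: "f \<in> points F \<Longrightarrow> real_scale s f \<in> points F"
proof -
  assume f: "f \<in> points F"
  have "(fst (f j), \<lambda>l\<in>{..<b j}. s * snd (f j) l) \<in> carrier (ZR_group (a j) (b j))" if "j \<in> {1..k}" for j
    using free_nilspace_component[OF f that] by (simp add: carrier_ZR_group mem_Times_iff)
  then show "real_scale s f \<in> points F"
    by (simp add: points_free_nilspace real_scale_def)
qed

lemma real_scale_1: "f \<in> points F \<Longrightarrow> real_scale 1 f = f"
  by (rule free_nilspace_eqI[OF real_scale_points])
    (auto simp: real_scale_def ZR_coord_def)

lemma real_scale_0: "real_scale s (real_scale 0 f) = real_scale 0 f"
  by (auto simp: real_scale_def fun_eq_iff)

lemma lattice_embed_part: "f \<in> points F \<Longrightarrow> lattice_embed (lattice_part f) = real_scale 0 f"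
  by (rule free_nilspace_eqI[OF lattice_embed_points real_scale_points])
    (auto simp: real_scale_def lattice_embed_def lattice_part_def lattice_index_def ZR_coord_def)

lemma lattice_part_scale: "lattice_part (real_scale s f) = lattice_part f"
  by (auto simp: real_scale_def lattice_part_def lattice_index_def fun_eq_iff)

lemma lattice_embed_cube:
  assumes c: "lattice_cube lattice_index fst n c"
  shows "(\<lambda>v\<in>dcube n. lattice_embed (c v)) \<in> cubes F n"
  unfolding cubes_free_nilspace_iff
proof (intro conjI ballI)
  show "(\<lambda>v\<in>dcube n. lattice_embed (c v)) \<in> dcube n \<rightarrow>\<^sub>E points F"
    using lattice_embed_points by auto
  fix j i assume j: "j \<in> {1..k}" and i: "i \<in> ZR_index (a j) (b j)"
  show "deg_le {0} j n (\<lambda>v. ZR_coord i ((\<lambda>v\<in>dcube n. lattice_embed (c v)) v j))"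
  proof (cases i)
    case (Inl l)
    have "deg_le {0} j n (\<lambda>v. real_of_int (c v (j, l)))"
      using c i j Inl by (force simp: lattice_cube_def lattice_index_def)
    then show ?thesis
      by (rule deg_le_eqI) (use i j Inl in \<open>auto simp: ZR_coord_def lattice_embed_def\<close>)
  next
    case (Inr l)
    show ?thesis
      by (rule deg_le_eqI[OF deg_le_const[of _ _ _ 0]]) (use i j Inr in \<open>auto simp: ZR_coord_def lattice_embed_def\<close>)
  qed
qed

lemma lattice_part_cube:
  assumes c: "c \<in> cubes F n"
  shows "lattice_cube lattice_index fst n (\<lambda>v. lattice_part (c v))"
  unfolding lattice_cube_def
proof (intro conjI ballI)
  fix e assume "e \<in> lattice_index"
  then obtain j l where e: "e = (j, l)" "j \<in> {1..k}" "l < a j"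
    by (auto simp: lattice_index_def)
  then have "deg_le {0} j n (\<lambda>v. ZR_coord (Inl l) (c v j))"
    using c by (auto simp: cubes_free_nilspace_iff)
  then show "deg_le {0} (fst e) n (\<lambda>v. real_of_int (lattice_part (c v) e))"
    using \<open>e \<in> lattice_index\<close> by (simp add: e ZR_coord_def lattice_part_def)
qed (auto simp: lattice_part_def)

lemma deg_le_cmult:
  assumes "deg_le {0} d n g" shows "deg_le {0} d n (\<lambda>v. x * g v)"
  using assms by (simp add: deg_le_def altsum_cmult)

lemma real_scale_cube:
  assumes c: "c \<in> cubes F n"
  shows "(\<lambda>v\<in>dcube n. real_scale s (c v)) \<in> cubes F n"
  unfolding cubes_free_nilspace_iff
proof (intro conjI ballI)
  have mem: "c v \<in> points F" if "v \<in> dcube n" for v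
    using c that unfolding cubes_free_nilspace_iff by blast
  show "(\<lambda>v\<in>dcube n. real_scale s (c v)) \<in> dcube n \<rightarrow>\<^sub>E points F"
    using real_scale_points mem by auto
  fix j i assume j: "j \<in> {1..k}" and i: "i \<in> ZR_index (a j) (b j)"
  have ci: "deg_le {0} j n (\<lambda>v. ZR_coord i (c v j))"
    using c i j by (auto simp: cubes_free_nilspace_iff)
  show "deg_le {0} j n (\<lambda>v. ZR_coord i ((\<lambda>v\<in>dcube n. real_scale s (c v)) v j))"
  proof (cases i)
    case (Inl l)
    show ?thesis
      by (rule deg_le_eqI[OF ci]) (use i j Inl in \<open>auto simp: ZR_coord_def real_scale_def\<close>)
  next
    case (Inr l)
    show ?thesis
      by (rule deg_le_eqI[OF deg_le_cmult[OF ci]]) (use i j Inr in \<open>auto simp: ZR_coord_def real_scale_def\<close>)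
  qed
qed

lemma continuous_free_fst:
  assumes "j \<in> {1..k}" "l < a j"
  shows "continuous_map (ctop F) (discrete_topology UNIV) (\<lambda>f. fst (f j) l)"
proof -
  have "continuous_map (ctop F) (ZR_topology (a j) (b j)) (\<lambda>f. f j)"
    unfolding ctop_free_nilspace using assms by (intro continuous_map_product_projection)
  moreover have "continuous_map (ZR_topology (a j) (b j)) (discrete_topology UNIV) ((\<lambda>x. x l) \<circ> fst)"
    unfolding ZR_topology_def using assms
    by (intro continuous_map_compose[OF continuous_map_fst] continuous_map_product_projection) auto
  ultimately show ?thesis
    using continuous_map_compose by (fastforce simp: o_def)
qed

lemma continuous_free_snd:
  assumes "j \<in> {1..k}" "l < b j"
  shows "continuous_map (ctop F) euclideanreal (\<lambda>f. snd (f j) l)"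
proof -
  have "continuous_map (ctop F) (ZR_topology (a j) (b j)) (\<lambda>f. f j)"
    unfolding ctop_free_nilspace using assms by (intro continuous_map_product_projection)
  moreover have "continuous_map (ZR_topology (a j) (b j)) euclideanreal ((\<lambda>x. x l) \<circ> snd)"
    unfolding ZR_topology_def using assms
    by (intro continuous_map_compose[OF continuous_map_snd] continuous_map_product_projection) auto
  ultimately show ?thesis
    using continuous_map_compose by (fastforce simp: o_def)
qed

lemma continuous_real_scale:
  "continuous_map (prod_topology (top_of_set {0..1}) (ctop F)) (ctop F) (\<lambda>(s, f). real_scale s f)"
proof -
  define Y where "Y = prod_topology (top_of_set {0..1::real}) (ctop F)"
  have fstY: "continuous_map Y euclideanreal fst"
    unfolding Y_def by (metis continuous_map_fst continuous_map_into_fulltopology)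
  have sndY: "continuous_map Y (ctop F) snd"
    unfolding Y_def by (rule continuous_map_snd)
  have "continuous_map Y (ZR_topology (a j) (b j)) (\<lambda>z. real_scale (fst z) (snd z) j)" if j: "j \<in> {1..k}" for j
  proof -
    have "continuous_map Y (product_topology (\<lambda>_. discrete_topology UNIV) {..<a j}) (\<lambda>z. fst (snd z j))"
      unfolding continuous_map_componentwise
    proof (intro conjI ballI)
      show "(\<lambda>z. fst (snd z j)) ` topspace Y \<subseteq> extensional {..<a j}"
        using free_nilspace_component[OF _ j] by (fastforce simp: Y_def carrier_ZR_group PiE_iff)
      fix l assume l: "l \<in> {..<a j}"
      show "continuous_map Y (discrete_topology UNIV) (\<lambda>z. fst (snd z j) l)"
        using continuous_map_compose[OF sndY continuous_free_fst[OF j, of l]] l by (simp add: o_def)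
    qed
    moreover have "continuous_map Y (product_topology (\<lambda>_. euclideanreal) {..<b j}) (\<lambda>z. \<lambda>l\<in>{..<b j}. fst z * snd (snd z j) l)"
      unfolding continuous_map_componentwise
    proof (intro conjI ballI)
      fix l assume l: "l \<in> {..<b j}"
      then have "continuous_map Y euclideanreal (\<lambda>z. fst z * snd (snd z j) l)"
        using continuous_map_compose[OF sndY continuous_free_snd[OF j, of l]]
        by (intro continuous_map_real_mult fstY) (auto simp: o_def)
      then show "continuous_map Y euclideanreal (\<lambda>z. (\<lambda>l\<in>{..<b j}. fst z * snd (snd z j) l) l)"
        using l by simp
    qed auto
    ultimately show ?thesis
      unfolding ZR_topology_def real_scale_def using j by (simp add: continuous_map_pairedI)
  qed
  then have "continuous_map Y (product_topology (\<lambda>j. ZR_topology (a j) (b j)) {1..k}) (\<lambda>z. real_scale (fst z) (snd z))"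
    unfolding continuous_map_componentwise by (auto simp: real_scale_def)
  then show ?thesis
    by (simp only: Y_def ctop_free_nilspace case_prod_unfold)
qed

text \<open>\<open>U\<close> is arbitrary: finitely many discrete coordinates determine the value,
  so the function is locally constant.\<close>

lemma continuous_lattice_part:
  "continuous_map (ctop F) euclideanreal (\<lambda>f. U (lattice_part f))"
  unfolding Met_TC.continuous_map_to_metric[of "ctop F" "\<lambda>f. U (lattice_part f)", simplified]
proof (intro ballI allI impI)
  fix f and \<epsilon> :: real assume f: "f \<in> points F" and \<epsilon>: "0 < \<epsilon>"
  define N where "N = (\<Inter>(j, l)\<in>lattice_index. {g \<in> points F. fst (g j) l \<in> {fst (f j) l}}) \<inter> points F"
  have "finite lattice_index" by (simp add: lattice_index_def)
  then have N: "openin (ctop F) N"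
    unfolding N_def
  proof (intro openin_INT)
    fix e assume "e \<in> lattice_index"
    then obtain j l where e: "e = (j, l)" "j \<in> {1..k}" "l < a j"
      by (auto simp: lattice_index_def)
    show "openin (ctop F) (case e of (j, l) \<Rightarrow> {g \<in> points F. fst (g j) l \<in> {fst (f j) l}})"
      unfolding e(1) prod.case
      by (rule openin_continuous_map_preimage[OF continuous_free_fst[OF e(2,3)]]) simp
  qed
  have fN: "f \<in> N" using f by (auto simp: N_def)
  have eq: "lattice_part g = lattice_part f" if "g \<in> N" for g
  proof
    fix e
    have "fst (g j) l = fst (f j) l" if "(j, l) \<in> lattice_index" for j l
      using \<open>g \<in> N\<close> that unfolding N_def by blast
    then show "lattice_part g e = lattice_part f e"
      by (cases e) (simp add: lattice_part_def)
  qed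
  show "\<exists>N. openin (ctop F) N \<and> f \<in> N \<and> (\<forall>y\<in>N. dist (U (lattice_part f)) (U (lattice_part y)) < \<epsilon>)"
  proof (intro exI[of _ N] conjI ballI N fN)
    fix y assume "y \<in> N"
    show "dist (U (lattice_part f)) (U (lattice_part y)) < \<epsilon>"
      unfolding eq[OF \<open>y \<in> N\<close>] using \<epsilon> by simp
  qed
qed

text \<open>The lift on lattice points is carried to all of \<open>F\<close> by
  \<open>real_scale\<close>. It has to be an exact morphism there, since continuity in the scale
  only propagates what holds at scale 0.\<close>

lemma free_lift:
  assumes w: "scalar_morphism \<int> F d w"
    and cw: "continuous_map (ctop F) euclidean (\<lambda>f. cis (2 * pi * w f))"
  obtains W where "continuous_map (ctop F) euclideanreal W"
    "\<And>f. f \<in> points F \<Longrightarrow> W f - w f \<in> \<int>" "scalar_morphism {0} F d W"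
proof -
  have "lattice_morphism \<int> lattice_index fst d (\<lambda>m. w (lattice_embed m))"
    unfolding lattice_morphism_def
  proof (intro allI impI)
    fix n c assume "lattice_cube lattice_index fst n (c :: (nat \<Rightarrow> nat) \<Rightarrow> nat \<times> nat \<Rightarrow> int)"
    then have "deg_le \<int> d n (\<lambda>v. w ((\<lambda>v\<in>dcube n. lattice_embed (c v)) v))"
      using w lattice_embed_cube unfolding scalar_morphism_def by blast
    then show "deg_le \<int> d n (\<lambda>v. w (lattice_embed (c v)))"
      by (rule deg_le_eqI) simp
  qed
  moreover have "finite lattice_index" "\<And>e. e \<in> lattice_index \<Longrightarrow> 0 < fst e"
    by (auto simp: lattice_index_def)
  ultimately obtain U where U: "lattice_morphism {0} lattice_index fst d U"
      "\<And>m. (\<forall>e. e \<notin> lattice_index \<longrightarrow> m e = 0) \<Longrightarrow> U m - w (lattice_embed m) \<in> \<int>"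
    using lattice_lift[of lattice_index fst d "\<lambda>m. w (lattice_embed m)"] by blast
  \<comment> \<open>Starting values of the lifted paths: the lattice lift, constant along the real
    coordinates.\<close>
  define V where "V f = U (lattice_part f)" for f
  have V: "V f - w (real_scale 0 f) \<in> \<int>" if "f \<in> points F" for f
    using U(2)[of "lattice_part f"] lattice_embed_part[OF that] by (auto simp: V_def lattice_part_def)
  obtain W where W: "continuous_map (ctop F) euclideanreal W"
      "\<And>f. f \<in> points F \<Longrightarrow> W f - w f \<in> \<int>"
      "\<And>f. f \<in> points F \<Longrightarrow> W (real_scale 0 f) = V (real_scale 0 f)"
    using topological_lift[of "ctop F" real_scale w V, OF continuous_real_scale real_scale_1 real_scale_0 cw _ V]
      continuous_lattice_part[of U] unfolding V_def by blast
  have "altsum (d + 1) (\<lambda>v. W (c (\<phi> v))) = 0"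
    if c: "c \<in> cubes F n" and \<phi>: "\<phi> \<in> dcube_morphism (d + 1) n" for n c \<phi>
  proof -
    have mem: "c (\<phi> v) \<in> points F" if "v \<in> dcube (d + 1)" for v
      using c dcube_morphism_app[OF \<phi> that] unfolding cubes_free_nilspace_iff by blast
    define f where "f s = altsum (d + 1) (\<lambda>v. W (real_scale s (c (\<phi> v))))" for s
    have "f 1 = f 0"
    proof (rule Ints_valued_continuous_constant)
      have "continuous_on {0..1} (\<lambda>s. W (real_scale s g))" if "g \<in> points F" for g
        using continuous_map_compose[OF continuous_map_compose[OF continuous_map_path_const[OF that] continuous_real_scale] W(1)]
        by (simp add: o_def)
      then show "continuous_on {0..1} f"
        unfolding f_def altsum_def using mem by (intro continuous_intros) auto
      fix s :: real
      have "deg_le \<int> d n (\<lambda>v. w ((\<lambda>v\<in>dcube n. real_scale s (c v)) v))"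
        using w real_scale_cube[OF c] unfolding scalar_morphism_def by blast
      then have "altsum (d + 1) (\<lambda>v. w ((\<lambda>v\<in>dcube n. real_scale s (c v)) (\<phi> v))) \<in> \<int>"
        using \<phi> by (auto simp: deg_le_def)
      then have "altsum (d + 1) (\<lambda>v. w (real_scale s (c (\<phi> v)))) \<in> \<int>"
        by (subst altsum_cong[where g' = "\<lambda>v. w ((\<lambda>v\<in>dcube n. real_scale s (c v)) (\<phi> v))"])
          (simp_all add: dcube_morphism_app[OF \<phi>] del: One_nat_def Suc_eq_plus1 add_Suc_right)
      moreover have "f s - altsum (d + 1) (\<lambda>v. w (real_scale s (c (\<phi> v)))) \<in> \<int>"
        unfolding f_def altsum_diff[symmetric]
        using mem by (intro altsum_in W(2) real_scale_points add_subgroup_Ints)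
      ultimately show "f s \<in> \<int>"
        using subgroup_cong[OF add_subgroup_Ints] by blast
    qed simp
    also have "f 0 = altsum (d + 1) (\<lambda>v. U (lattice_part (c (\<phi> v))))"
      unfolding f_def by (rule altsum_cong) (simp add: W(3)[OF mem] V_def lattice_part_scale)
    also have "\<dots> = 0"
      using U(1) lattice_part_cube[OF c] \<phi> unfolding lattice_morphism_def deg_le_def by blast
    finally have "f 1 = 0" .
    then show ?thesis
      using altsum_cong[of "d + 1" "\<lambda>v. W (c (\<phi> v))" "\<lambda>v. W (real_scale 1 (c (\<phi> v)))"] mem
      by (simp add: real_scale_1 f_def)
  qed
  then have "scalar_morphism {0} F d W"
    by (simp add: scalar_morphism_def deg_le_def)
  with W(1,2) show thesis by (rule that)
qed

end

section \<open>Translations of a product with a degree-k nilspace\<close>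

lemma ctop_prod_cubespace [simp]: "ctop (X \<times>\<^sub>C Y) = prod_topology (ctop X) (ctop Y)"
  by (simp add: prod_cubespace_def)

lemma cubes_prod_cubespace_iff:
  "c \<in> cubes (X \<times>\<^sub>C Y) n \<longleftrightarrow> c \<in> dcube n \<rightarrow>\<^sub>E points X \<times> points Y \<and>
    (\<lambda>v\<in>dcube n. fst (c v)) \<in> cubes X n \<and> (\<lambda>v\<in>dcube n. snd (c v)) \<in> cubes Y n"
  by (simp add: prod_cubespace_def)

text \<open>The face used for tests in \<open>i\<close> fresh dimensions; its indicator is the
  monomial of the new coordinates.\<close>

definition last_face :: "nat \<Rightarrow> nat \<Rightarrow> (nat \<Rightarrow> nat) set" where
  "last_face n i = {v \<in> dcube (n + i). \<forall>l\<in>{n..<n + i}. v l = 1}"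

lemma last_face_in: "last_face n i \<in> dcube_faces (n + i) i"
  unfolding dcube_faces_def last_face_def
  by (intro CollectI exI[of _ "{n..<n + i}"] exI[of _ "\<lambda>_. 1"]) auto

lemma vmono_last_face:
  "v \<in> dcube (n + i) \<Longrightarrow> vmono {n..<n + i} v = (if v \<in> last_face n i then 1 else 0)"
  by (subst vmono_eq) (auto simp: last_face_def)

lemma translationD:
  assumes "translation i X \<alpha>" "c \<in> cubes X n" "F' \<in> dcube_faces n i"
  shows "(\<lambda>v\<in>dcube n. if v \<in> F' then \<alpha> (c v) else c v) \<in> cubes X n"
  using assms by (auto simp: translation_def)

locale free_translation = character_system G K J \<xi>
  for G :: "'a monoid" (structure) and K and J :: "'j set" and \<xi> +
  fixes k i :: nat and a b :: "nat \<Rightarrow> nat" and T :: "'a topology"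
    and \<alpha> :: "(nat \<Rightarrow> (nat \<Rightarrow> int) \<times> (nat \<Rightarrow> real)) \<times> 'a \<Rightarrow> (nat \<Rightarrow> (nat \<Rightarrow> int) \<times> (nat \<Rightarrow> real)) \<times> 'a"
  assumes T: "topspace T = carrier G"
    and i: "1 \<le> i" "i \<le> k"
    and \<alpha>: "translation i (free_nilspace k a b \<times>\<^sub>C \<D> k G T) \<alpha>"
begin

abbreviation "F \<equiv> free_nilspace k a b"
abbreviation "X \<equiv> F \<times>\<^sub>C \<D> k G T"

text \<open>\<open>base\<close> and \<open>displacement\<close> are the maps
  \<open>\<alpha>\<^sub>F\<close> and \<open>w\<close> of the overview. Evaluation at
  \<open>\<one>\<close> loses nothing, by \<open>\<alpha>_shift\<close>.\<close>

definition base :: "(nat \<Rightarrow> (nat \<Rightarrow> int) \<times> (nat \<Rightarrow> real)) \<Rightarrow> nat \<Rightarrow> (nat \<Rightarrow> int) \<times> (nat \<Rightarrow> real)" where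
  "base f = fst (\<alpha> (f, \<one>))"

definition displacement :: "(nat \<Rightarrow> (nat \<Rightarrow> int) \<times> (nat \<Rightarrow> real)) \<Rightarrow> 'a" where
  "displacement f = snd (\<alpha> (f, \<one>))"

lemma \<alpha>_points: "f \<in> points F \<Longrightarrow> y \<in> carrier G \<Longrightarrow> \<alpha> (f, y) \<in> points F \<times> carrier G"
  using \<alpha> T by (auto simp: translation_def)

lemma base_points: "f \<in> points F \<Longrightarrow> base f \<in> points F"
  using \<alpha>_points[of f \<one>] by (auto simp: base_def)

lemma cube_pairI:
  assumes c: "c \<in> cubes F n" and y: "y \<in> dcube n \<rightarrow> carrier G"
    and deg: "\<And>j. j \<in> J \<Longrightarrow> deg_le K k n (\<lambda>v. \<xi> j (y v))"
  shows "(\<lambda>v\<in>dcube n. (c v, y v)) \<in> cubes X n"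
  unfolding cubes_prod_cubespace_iff
proof (intro conjI)
  have cP: "c \<in> dcube n \<rightarrow>\<^sub>E points F"
    using c by (simp add: cubes_free_nilspace_iff)
  then show "(\<lambda>v\<in>dcube n. (c v, y v)) \<in> dcube n \<rightarrow>\<^sub>E points F \<times> points (\<D> k G T)"
    using y T by (auto simp del: PiE_restrict dest: PiE_mem)
  have "(\<lambda>v\<in>dcube n. fst ((\<lambda>v\<in>dcube n. (c v, y v)) v)) = c"
    using cP by (auto simp: fun_eq_iff PiE_iff extensional_def)
  then show "(\<lambda>v\<in>dcube n. fst ((\<lambda>v\<in>dcube n. (c v, y v)) v)) \<in> cubes F n"
    using c by simp
  show "(\<lambda>v\<in>dcube n. snd ((\<lambda>v\<in>dcube n. (c v, y v)) v)) \<in> cubes (\<D> k G T) n"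
    unfolding cubes_Dnil_iff
  proof (intro conjI ballI)
    fix j assume "j \<in> J"
    from deg[OF this] show "deg_le K k n (\<lambda>v. \<xi> j ((\<lambda>v\<in>dcube n. snd ((\<lambda>v\<in>dcube n. (c v, y v)) v)) v))"
      by (rule deg_le_eqI) simp
  qed (use y in auto)
qed

lemma cube_fst_coord:
  assumes "c \<in> cubes X n" "j \<in> {1..k}" "l \<in> ZR_index (a j) (b j)"
  shows "deg_le {0} j n (\<lambda>v. ZR_coord l (fst (c v) j))"
proof -
  have "deg_le {0} j n (\<lambda>v. ZR_coord l ((\<lambda>v\<in>dcube n. fst (c v)) v j))"
    using assms unfolding cubes_prod_cubespace_iff cubes_free_nilspace_iff by blast
  then show ?thesis by (rule deg_le_eqI) simp
qed

lemma cube_snd_coord: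
  assumes "c \<in> cubes X n" "j \<in> J"
  shows "deg_le K k n (\<lambda>v. \<xi> j (snd (c v)))"
proof -
  have "deg_le K k n (\<lambda>v. \<xi> j ((\<lambda>v\<in>dcube n. snd (c v)) v))"
    using assms unfolding cubes_prod_cubespace_iff cubes_Dnil_iff by blast
  then show ?thesis by (rule deg_le_eqI) simp
qed

lemma base_translation:
  assumes c: "c \<in> cubes F n" and F': "F' \<in> dcube_faces n i"
  shows "(\<lambda>v\<in>dcube n. if v \<in> F' then base (c v) else c v) \<in> cubes F n"
proof -
  have "(\<lambda>v\<in>dcube n. (c v, \<one>)) \<in> cubes X n"
    by (rule cube_pairI[OF c]) (auto intro: deg_le_const K)
  from translationD[OF \<alpha> this F']
  have "(\<lambda>v\<in>dcube n. fst ((\<lambda>v\<in>dcube n. if v \<in> F' then \<alpha> ((\<lambda>v\<in>dcube n. (c v, \<one>)) v)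
      else (\<lambda>v\<in>dcube n. (c v, \<one>)) v) v)) \<in> cubes F n"
    unfolding cubes_prod_cubespace_iff by blast
  also have "(\<lambda>v\<in>dcube n. fst ((\<lambda>v\<in>dcube n. if v \<in> F' then \<alpha> ((\<lambda>v\<in>dcube n. (c v, \<one>)) v)
      else (\<lambda>v\<in>dcube n. (c v, \<one>)) v) v)) = (\<lambda>v\<in>dcube n. if v \<in> F' then base (c v) else c v)"
    by (auto simp: base_def)
  finally show ?thesis .
qed

text \<open>The cube is extended by \<open>i\<close> dimensions on which it does not depend, and
  \<alpha> acts where these are all 1. Modulo \<open>K\<close> the second component is the
  displacement times the indicator of that face; it has degree \<open>k\<close>, and dropping the
  fresh coordinates leaves \<open>k - i\<close>.\<close>

lemma displacement_degree:
  assumes j: "j \<in> J"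
  shows "scalar_morphism K F (k - i) (\<lambda>f. \<xi> j (displacement f))"
  unfolding scalar_morphism_def
proof (intro allI ballI)
  fix n c assume c: "c \<in> cubes F n"
  then have cP: "c \<in> dcube n \<rightarrow>\<^sub>E points F"
    by (simp add: cubes_free_nilspace_iff)
  define p where "p = (\<lambda>v\<in>dcube (n + i). c (restrict v {..<n}))"
  have r: "restrict v {..<n} \<in> dcube n" if "v \<in> dcube (n + i)" for v
    using dcube_restrict[OF that] by simp
  have p: "p \<in> cubes F (n + i)"
    unfolding cubes_free_nilspace_iff
  proof (intro conjI ballI)
    show "p \<in> dcube (n + i) \<rightarrow>\<^sub>E points F"
      using PiE_mem[OF cP r] by (auto simp: p_def)
    fix j l assume "j \<in> {1..k}" "l \<in> ZR_index (a j) (b j)"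
    then have "deg_le {0} j n (\<lambda>v. ZR_coord l (c v j))"
      using c by (auto simp: cubes_free_nilspace_iff)
    from deg_le_pullback[OF add_subgroup_zero this, of "n + i"]
    have "deg_le {0} j (n + i) (\<lambda>v. ZR_coord l (c (restrict v {..<n}) j))" by simp
    then show "deg_le {0} j (n + i) (\<lambda>v. ZR_coord l (p v j))"
      by (rule deg_le_eqI) (simp add: p_def)
  qed
  have "(\<lambda>v\<in>dcube (n + i). (p v, \<one>)) \<in> cubes X (n + i)"
    by (rule cube_pairI[OF p]) (auto intro: deg_le_const K)
  from cube_snd_coord[OF translationD[OF \<alpha> this last_face_in] j]
  have "deg_le K k (n + i) (\<lambda>v. vmono {n..<n + i} v * \<xi> j (displacement (c (restrict v {..<n}))))"
  proof (rule deg_le_congruent[OF K, rotated])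
    fix v assume v: "v \<in> dcube (n + i)"
    \<comment> \<open>Off the face the second component is \<open>\<one>\<close>, whose characters
      lie in \<open>K\<close> but need not be 0, so the functions agree only modulo
      \<open>K\<close>.\<close>
    show "vmono {n..<n + i} v * \<xi> j (displacement (c (restrict v {..<n}))) -
      \<xi> j (snd ((\<lambda>v\<in>dcube (n + i). if v \<in> last_face n i then \<alpha> ((\<lambda>v\<in>dcube (n + i). (p v, \<one>)) v)
         else (\<lambda>v\<in>dcube (n + i). (p v, \<one>)) v) v)) \<in> K"
      using v subgroup_0[OF K] subgroup_minus[OF K one_char[OF j]]
      by (simp add: vmono_last_face displacement_def p_def)
  qed
  then have "deg_le K (k - i + i) (n + i) (\<lambda>v. vmono {n..<n + i} v * \<xi> j (displacement (c (restrict v {..<n}))))"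
    using i by simp
  then show "deg_le K (k - i) n (\<lambda>v. \<xi> j (displacement (c v)))"
    by (rule deg_le_drop_coords[OF K, where g = "\<lambda>v. \<xi> j (displacement (c v))"])
qed

text \<open>In a \<open>(k + 1)\<close>-cube \<open>y\<close> is placed where the first
  \<open>k\<close> coordinates are 1, and \<alpha> acts where the last \<open>i\<close> are 1. As
  \<open>i \<ge> 1\<close>, these faces meet in one vertex, so a deviation from the product form is
  a coefficient of the full monomial; degree \<open>k\<close> makes it 0 in the first component and
  puts it in \<open>K\<close> in the second.\<close>

lemma \<alpha>_shift:
  assumes f: "f \<in> points F" and y: "y \<in> carrier G"
  shows "fst (\<alpha> (f, y)) = base f"
    and "j \<in> J \<Longrightarrow> \<xi> j (snd (\<alpha> (f, y))) - (\<xi> j (displacement f) + \<xi> j y) \<in> K"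
proof -
  define S where "S = {..<k}"
  \<comment> \<open>For \<open>i > 1\<close> this overlaps \<open>S\<close>; the product of the two
    monomials is the full monomial all the same.\<close>
  define R where "R = {k + 1 - i..<k + 1}"
  have eq: "k + 1 - i + i = k + 1" using i by simp
  have SR: "S \<subseteq> {..<k + 1}" "R \<subseteq> {..<k + 1}" "card S = k" "card R = i" "S \<union> R = {..<k + 1}"
    using i by (auto simp: S_def R_def)
  define e where "e v = (if vmono S v = 1 then y else \<one>)" for v
  define c where "c = (\<lambda>v\<in>dcube (k + 1). (f, e v))"
  have S01: "vmono S v = 1 \<or> vmono S v = 0" if "v \<in> dcube (k + 1)" for v
    using vmono_eq[OF that SR(1)] by auto
  have e_deg: "deg_le K k (k + 1) (\<lambda>v. \<xi> j (e v))" if "j \<in> J" for j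
  proof (rule deg_le_eqI[OF deg_le_add[OF K deg_le_const[OF K, of _ _ "\<xi> j \<one>"]
        deg_le_vmono[OF K SR(1), of k "\<xi> j y - \<xi> j \<one>"]]])
    show "\<xi> j (e v) = \<xi> j \<one> + (\<xi> j y - \<xi> j \<one>) * vmono S v" if "v \<in> dcube (k + 1)" for v
      using S01[OF that] by (auto simp: e_def)
  qed (simp add: SR)
  have fc: "(\<lambda>v\<in>dcube (k + 1). f) \<in> cubes F (k + 1)"
    unfolding cubes_free_nilspace_iff
  proof (intro conjI ballI)
    fix j l
    show "deg_le {0} j (k + 1) (\<lambda>v. ZR_coord l ((\<lambda>v\<in>dcube (k + 1). f) v j))"
      by (rule deg_le_eqI[OF deg_le_const[OF add_subgroup_zero]]) simp
  qed (use f in auto)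
  have "(\<lambda>v\<in>dcube (k + 1). ((\<lambda>v\<in>dcube (k + 1). f) v, e v)) \<in> cubes X (k + 1)"
    by (rule cube_pairI[OF fc _ e_deg]) (auto simp: e_def y)
  moreover have "(\<lambda>v\<in>dcube (k + 1). ((\<lambda>v\<in>dcube (k + 1). f) v, e v)) = c"
    by (auto simp: c_def)
  ultimately have c: "c \<in> cubes X (k + 1)" by simp
  define c' where "c' = (\<lambda>v\<in>dcube (k + 1). if v \<in> last_face (k + 1 - i) i then \<alpha> (c v) else c v)"
  have c': "c' \<in> cubes X (k + 1)"
    unfolding c'_def using translationD[OF \<alpha> c] last_face_in[of "k + 1 - i" i] by (simp only: eq)
  have R01: "vmono R v = (if v \<in> last_face (k + 1 - i) i then 1 else 0)" if "v \<in> dcube (k + 1)" for v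
    using vmono_last_face[of v "k + 1 - i" i] that unfolding R_def eq by blast
  have prod: "vmono {..<k + 1} v = vmono S v * vmono R v" if "v \<in> dcube (k + 1)" for v
    using vmono_mult[OF that SR(1,2)] by (simp add: SR(5))
  have c'_eq: "c' v = (if vmono R v = 1 then \<alpha> (f, if vmono S v = 1 then y else \<one>)
      else (f, if vmono S v = 1 then y else \<one>))" if "v \<in> dcube (k + 1)" for v
    using R01[OF that] that by (simp add: c'_def c_def e_def)
  show "fst (\<alpha> (f, y)) = base f"
  proof (rule free_nilspace_eqI[OF _ base_points[OF f]])
    show "fst (\<alpha> (f, y)) \<in> points F" using \<alpha>_points[OF f y] by auto
    fix j l assume j: "j \<in> {1..k}" "l \<in> ZR_index (a j) (b j)"
    define z where "z x = ZR_coord l (x j)" for x :: "nat \<Rightarrow> (nat \<Rightarrow> int) \<times> (nat \<Rightarrow> real)"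
    \<comment> \<open>The component of degree \<open>j\<close> is regarded as one of degree
      \<open>k\<close>, so that dimension \<open>k + 1\<close> isolates its leading
      coefficient.\<close>
    have "deg_le {0} k (k + 1) (\<lambda>v. z (fst (c' v)))"
      unfolding z_def by (rule deg_le_mono[OF _ cube_fst_coord[OF c' j]]) (use j in auto)
    moreover have "deg_le {0} k (k + 1) (\<lambda>v. z f + (z (base f) - z f) * vmono R v)"
      using i SR by (intro deg_le_add deg_le_const deg_le_vmono) auto
    ultimately have "z (fst (\<alpha> (f, y))) - z (base f) \<in> {0}"
    proof (rule deg_le_leading_coeff[OF add_subgroup_zero])
      fix v assume v: "v \<in> dcube (k + 1)"
      show "z (fst (c' v)) = z f + (z (base f) - z f) * vmono R v +
          (z (fst (\<alpha> (f, y))) - z (base f)) * vmono {..<k + 1} v"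
        unfolding prod[OF v] c'_eq[OF v] using S01[OF v] R01[OF v] by (auto simp: base_def)
    qed
    then show "ZR_coord l (fst (\<alpha> (f, y)) j) = ZR_coord l (base f j)" by (simp add: z_def)
  qed
  show "\<xi> j (snd (\<alpha> (f, y))) - (\<xi> j (displacement f) + \<xi> j y) \<in> K" if j: "j \<in> J"
  proof -
    \<comment> \<open>The extra \<open>\<xi> j \<one>\<close> is what the interpolation leaves at
      the top vertex; it lies in \<open>K\<close> and is removed at the end.\<close>
    define D where "D = \<xi> j (snd (\<alpha> (f, y))) - (\<xi> j (displacement f) + \<xi> j y) + \<xi> j \<one>"
    have "deg_le K k (k + 1) (\<lambda>v. \<xi> j \<one> + (\<xi> j y - \<xi> j \<one>) * vmono S v + (\<xi> j (displacement f) - \<xi> j \<one>) * vmono R v)"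
      using i SR by (intro deg_le_add deg_le_const deg_le_vmono K) auto
    with cube_snd_coord[OF c' j] have "D \<in> K"
    proof (rule deg_le_leading_coeff[OF K])
      fix v assume v: "v \<in> dcube (k + 1)"
      show "\<xi> j (snd (c' v)) = \<xi> j \<one> + (\<xi> j y - \<xi> j \<one>) * vmono S v +
          (\<xi> j (displacement f) - \<xi> j \<one>) * vmono R v + D * vmono {..<k + 1} v"
        unfolding prod[OF v] c'_eq[OF v] using S01[OF v] R01[OF v]
        by (auto simp: displacement_def D_def)
    qed
    then show ?thesis
      using subgroup_diff[OF K _ one_char[OF j], of D] by (simp add: D_def)
  qed
qed

end

section \<open>Lifting along the covering homomorphism\<close>

text \<open>Distinct integers are at distance at least 1, so a set of integers is cut out by a union
  of open unit balls.\<close>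

lemma continuous_map_Ints_discrete:
  assumes g: "continuous_map Y euclideanreal (\<lambda>x. real_of_int (p x))"
  shows "continuous_map Y (discrete_topology UNIV) p"
  unfolding continuous_map_def
proof (intro conjI allI impI)
  fix U :: "int set"
  have "real_of_int q \<in> (\<Union>u\<in>U. ball (real_of_int u) 1) \<longleftrightarrow> q \<in> U" for q
  proof
    assume "real_of_int q \<in> (\<Union>u\<in>U. ball (real_of_int u) 1)"
    then obtain u where "u \<in> U" "\<bar>real_of_int u - real_of_int q\<bar> < 1"
      by (auto simp: dist_real_def)
    then have "u = q" by linarith
    then show "q \<in> U" using \<open>u \<in> U\<close> by simp
  qed force
  then have "{x \<in> topspace Y. p x \<in> U} = {x \<in> topspace Y. real_of_int (p x) \<in> (\<Union>u\<in>U. ball (real_of_int u) 1)}"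
    by simp
  moreover have "openin Y {x \<in> topspace Y. real_of_int (p x) \<in> (\<Union>u\<in>U. ball (real_of_int u) 1)}"
    by (rule openin_continuous_map_preimage[OF g]) auto
  ultimately show "openin Y {x \<in> topspace Y. p x \<in> U}" by simp
qed auto

lemma ZR_coord_continuous:
  assumes "j \<in> ZR_index a b"
  shows "continuous_map (ZR_topology a b) euclideanreal (ZR_coord j)"
proof (cases j)
  case (Inl l)
  then have "l \<in> {..<a}" using assms by auto
  have "continuous_map (ZR_topology a b) (discrete_topology UNIV) ((\<lambda>x. x l) \<circ> fst)"
    unfolding ZR_topology_def
    by (rule continuous_map_compose[OF continuous_map_fst continuous_map_product_projection[OF \<open>l \<in> {..<a}\<close>]])
  moreover have "continuous_map (discrete_topology UNIV) euclideanreal real_of_int"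
    by simp
  ultimately have "continuous_map (ZR_topology a b) euclideanreal (real_of_int \<circ> ((\<lambda>x. x l) \<circ> fst))"
    by (rule continuous_map_compose)
  then show ?thesis by (rule continuous_map_eq) (simp add: Inl ZR_coord_def)
next
  case (Inr l)
  then have "l \<in> {..<b}" using assms by auto
  have "continuous_map (ZR_topology a b) euclideanreal ((\<lambda>x. x l) \<circ> snd)"
    unfolding ZR_topology_def
    by (rule continuous_map_compose[OF continuous_map_snd continuous_map_product_projection[OF \<open>l \<in> {..<b}\<close>]])
  then show ?thesis by (rule continuous_map_eq) (simp add: Inr ZR_coord_def)
qed

lemma continuous_map_ZR_topologyI:
  assumes p: "\<And>x. x \<in> topspace Y \<Longrightarrow> p x \<in> carrier (ZR_group a b)"
    and coord: "\<And>j. j \<in> ZR_index a b \<Longrightarrow> continuous_map Y euclideanreal (\<lambda>x. ZR_coord j (p x))"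
  shows "continuous_map Y (ZR_topology a b) p"
proof -
  have "continuous_map Y (product_topology (\<lambda>_. discrete_topology UNIV) {..<a}) (fst \<circ> p)"
    unfolding continuous_map_componentwise
  proof (intro conjI ballI)
    show "(fst \<circ> p) ` topspace Y \<subseteq> extensional {..<a}"
      using p by (auto simp: carrier_ZR_group mem_Times_iff PiE_iff)
    fix l assume "l \<in> {..<a}"
    then show "continuous_map Y (discrete_topology UNIV) (\<lambda>x. (fst \<circ> p) x l)"
      using coord[OF InlI, of l] by (intro continuous_map_Ints_discrete) (simp add: ZR_coord_def)
  qed
  moreover have "continuous_map Y (product_topology (\<lambda>_. euclideanreal) {..<b}) (snd \<circ> p)"
    unfolding continuous_map_componentwise
  proof (intro conjI ballI)
    show "(snd \<circ> p) ` topspace Y \<subseteq> extensional {..<b}"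
      using p by (auto simp: carrier_ZR_group mem_Times_iff PiE_iff)
    fix l assume "l \<in> {..<b}"
    then show "continuous_map Y euclideanreal (\<lambda>x. (snd \<circ> p) x l)"
      using coord[OF InrI, of l] by (simp add: ZR_coord_def)
  qed
  ultimately show ?thesis
    by (simp add: ZR_topology_def continuous_map_pairwise)
qed

text \<open>The circle has the quotient topology, so continuity is tested after \<open>frac\<close>,
  whose jumps \<open>cis\<close> does not see.\<close>

lemma continuous_map_circle_cis:
  "continuous_map circle_topology euclidean (\<lambda>t. cis (2 * pi * t))"
proof (rule continuous_compose_quotient_map[OF quotient_map_frac])
  have "cis (2 * pi * frac x) = cis (2 * pi * x)" for x
    by (simp add: cis_2pi_eq_iff frac_diff_Ints)
  then have "(\<lambda>t. cis (2 * pi * t)) \<circ> frac = (\<lambda>t. cis (2 * pi * t))"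
    by (simp add: fun_eq_iff)
  moreover have "continuous_on UNIV (\<lambda>t. cis (2 * pi * t))"
    by (intro continuous_intros)
  ultimately show "continuous_map euclideanreal euclidean ((\<lambda>t. cis (2 * pi * t)) \<circ> frac)"
    by simp
qed

lemma ZT_coord_continuous:
  assumes "j \<in> ZR_index r s"
  shows "continuous_map (ZT_topology Z s) euclidean (\<lambda>x. cis (2 * pi * ZT_coord n g j x))"
proof (cases j)
  case (Inl l)
  have "continuous_map (ZT_topology Z s) euclidean ((\<lambda>z. cis (2 * pi * (real_of_int (g z l) / real (n l)))) \<circ> fst)"
    unfolding ZT_topology_def by (rule continuous_map_compose[OF continuous_map_fst]) simp
  then show ?thesis by (rule continuous_map_eq) (simp add: Inl ZT_coord_def)
next
  case (Inr l)
  then have "l \<in> {..<s}" using assms by auto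
  have "continuous_map (ZT_topology Z s) circle_topology ((\<lambda>x. x l) \<circ> snd)"
    unfolding ZT_topology_def
    by (rule continuous_map_compose[OF continuous_map_snd continuous_map_product_projection[OF \<open>l \<in> {..<s}\<close>]])
  from continuous_map_compose[OF this continuous_map_circle_cis] show ?thesis
    by (rule continuous_map_eq) (simp add: Inr ZT_coord_def)
qed

text \<open>Modulo \<int> the covering map is linear in coordinates: it divides integer coordinates
  by their moduli and keeps the real ones.\<close>

lemma covering_hom_coord:
  assumes h: "h \<in> iso (cyclic_product r n) Z" and n: "\<And>j. j < r \<Longrightarrow> 0 < n j"
    and g: "g = inv_into (carrier (cyclic_product r n)) h"
  shows "covering_hom r n h s y \<in> carrier (ZT_group Z s)"
    and "j \<in> ZR_index r s \<Longrightarrow> ZT_coord n g j (covering_hom r n h s y) -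
      ZR_coord j y / (case j of Inl l \<Rightarrow> real (n l) | Inr l \<Rightarrow> 1) \<in> \<int>"
proof -
  define z where "z = (\<lambda>j\<in>{..<r}. fst y j mod int (n j))"
  have z: "z \<in> carrier (cyclic_product r n)"
    using n by (auto simp: z_def carrier_integer_mod_group)
  have hom: "h \<in> hom (cyclic_product r n) Z" and inj: "inj_on h (carrier (cyclic_product r n))"
    using h by (auto simp: iso_def bij_betw_def)
  have \<pi>: "covering_hom r n h s y = (h z, \<lambda>j\<in>{..<s}. frac (snd y j))"
    by (simp add: covering_hom_def z_def case_prod_unfold)
  show "covering_hom r n h s y \<in> carrier (ZT_group Z s)"
    using hom_in_carrier[OF hom z] by (simp add: \<pi> ZT_group_def circle_group_def frac_lt_1)
  have "g (h z) = z"
    unfolding g by (rule inv_into_f_f[OF inj z])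
  then show "ZT_coord n g j (covering_hom r n h s y) -
      ZR_coord j y / (case j of Inl l \<Rightarrow> real (n l) | Inr l \<Rightarrow> 1) \<in> \<int>" if "j \<in> ZR_index r s"
    using that int_mod_div_diff_Ints[OF n]
    by (auto simp: \<pi> ZT_coord_def ZR_coord_def z_def frac_diff_Ints)
qed

theorem theorem3p13:
  fixes k r s i :: nat
    and a b n :: "nat \<Rightarrow> nat"
    and Z :: "'z monoid"
    and h :: "(nat \<Rightarrow> int) \<Rightarrow> 'z"
  defines "F \<equiv> free_nilspace k a b"
    and "DA \<equiv> \<D> k (ZT_group Z s) (ZT_topology Z s)"
    and "DB \<equiv> \<D> k (ZR_group r s) (ZR_topology r s)"
    and "\<pi> \<equiv> covering_hom r n h s"
  defines "\<phi> \<equiv> (\<lambda>(f, y). (f, \<pi> y))"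
  assumes "comm_group Z" and "finite (carrier Z)"
    and "r = finite_rank Z"
    and "\<And>j. j < r \<Longrightarrow> 0 < n j"
    and "h \<in> iso (cyclic_product r n) Z"
    and "i \<in> {1..k}"
    and "\<alpha> \<in> \<Theta> i (F \<times>\<^sub>C DA)"
  shows "\<exists>\<beta>\<in>\<Theta> i (F \<times>\<^sub>C DB). \<forall>x\<in>points (F \<times>\<^sub>C DB). \<alpha> (\<phi> x) = \<phi> (\<beta> x)"
proof -
  note n = \<open>\<And>j. j < r \<Longrightarrow> 0 < n j\<close> and h = \<open>h \<in> iso (cyclic_product r n) Z\<close>
  define g where "g = inv_into (carrier (cyclic_product r n)) h"
  have "group (cyclic_product r n)" by simp
  then have g: "g \<in> iso Z (cyclic_product r n)"
    unfolding g_def using h by (rule group.iso_set_sym)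
  have \<alpha>: "translation i (F \<times>\<^sub>C DA) \<alpha>" and c\<alpha>: "continuous_map (ctop (F \<times>\<^sub>C DA)) (ctop (F \<times>\<^sub>C DA)) \<alpha>"
    using \<open>\<alpha> \<in> \<Theta> i (F \<times>\<^sub>C DA)\<close> by (auto simp: cont_translations_def)
  interpret A: character_system "ZT_group Z s" \<int> "ZR_index r s" "ZT_coord n g"
    using \<open>comm_group Z\<close> n g by (rule character_system_ZT)
  interpret B: character_system "ZR_group r s" "{0}" "ZR_index r s" ZR_coord
    by (rule character_system_ZR)
  interpret free_translation "ZT_group Z s" \<int> "ZR_index r s" "ZT_coord n g" k i a b "ZT_topology Z s" \<alpha>
    using \<alpha> \<open>i \<in> {1..k}\<close> by unfold_locales (auto simp: topspace_ZT_topology F_def DA_def)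
  let ?one = "\<one>\<^bsub>ZT_group Z s\<^esub>"
  have c_one: "continuous_map (ctop F) (ctop (F \<times>\<^sub>C DA)) (\<lambda>f. (f, ?one))"
    by (auto simp: DA_def topspace_ZT_topology intro!: continuous_map_pairedI)
  from continuous_map_compose[OF this c\<alpha>]
  have c\<alpha>1: "continuous_map (ctop F) (prod_topology (ctop F) (ctop DA)) (\<lambda>f. \<alpha> (f, ?one))"
    by (simp add: o_def)
  have c_base: "continuous_map (ctop F) (ctop F) base"
    using continuous_map_compose[OF c\<alpha>1 continuous_map_fst] by (simp add: o_def base_def[abs_def])
  have c_disp: "continuous_map (ctop F) (ZT_topology Z s) displacement"
    using continuous_map_compose[OF c\<alpha>1 continuous_map_snd] by (simp add: o_def displacement_def[abs_def] DA_def)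
  have "\<exists>W. continuous_map (ctop F) euclideanreal W \<and>
      (\<forall>f\<in>points F. W f - ZT_coord n g j (displacement f) \<in> \<int>) \<and> scalar_morphism {0} F (k - i) W"
    if j: "j \<in> ZR_index r s" for j
  proof -
    have "continuous_map (ctop F) euclidean (\<lambda>f. cis (2 * pi * ZT_coord n g j (displacement f)))"
      using continuous_map_compose[OF c_disp ZT_coord_continuous[OF j]] by (simp add: o_def)
    then show ?thesis
      using free_lift[OF displacement_degree[OF j]] unfolding F_def by metis
  qed
  then obtain W where cW: "\<And>j. j \<in> ZR_index r s \<Longrightarrow> continuous_map (ctop F) euclideanreal (W j)"
    and W: "\<And>j f. j \<in> ZR_index r s \<Longrightarrow> f \<in> points F \<Longrightarrow> W j f - ZT_coord n g j (displacement f) \<in> \<int>"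
    and degW: "\<And>j. j \<in> ZR_index r s \<Longrightarrow> scalar_morphism {0} F (k - i) (W j)"
    by metis
  \<comment> \<open>Undoes the division by \<open>n l\<close> in the characters of the finite
    factors.\<close>
  define m where "m j = (case j of Inl l \<Rightarrow> real (n l) | Inr l \<Rightarrow> 1)" for j :: "nat + nat"
  have m: "m j \<noteq> 0" if "j \<in> ZR_index r s" for j
    using that by (auto simp: m_def dest: n)
  \<comment> \<open>On points of \<open>F\<close> the floor changes nothing:
    \<open>W (Inl l) f\<close> is congruent modulo \<int> to a multiple of
    \<open>1 / real (n l)\<close>. It makes \<open>L f\<close> a group element for every
    \<open>f\<close>.\<close>
  define L where "L f = (\<lambda>l\<in>{..<r}. \<lfloor>real (n l) * W (Inl l) f\<rfloor>, \<lambda>l\<in>{..<s}. W (Inr l) f)" for f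
  have L: "L f \<in> carrier (ZR_group r s)" for f
    by (simp add: L_def carrier_ZR_group)
  have L_coord: "ZR_coord j (L f) = m j * W j f" if j: "j \<in> ZR_index r s" and f: "f \<in> points F" for j f
  proof (cases j)
    case (Inl l)
    then have l: "l < r" using j by auto
    obtain t where "W (Inl l) f - real_of_int (g (fst (displacement f)) l) / real (n l) = of_int t"
      using W[OF j f] by (auto simp: Inl ZT_coord_def elim: Ints_cases)
    then have "real (n l) * W (Inl l) f = of_int (int (n l) * t + g (fst (displacement f)) l)"
      using n[OF l] by (simp add: field_simps)
    then show ?thesis
      using l by (simp add: Inl ZR_coord_def L_def m_def)
  next
    case (Inr l)
    then show ?thesis using j by (auto simp: ZR_coord_def L_def m_def)
  qed
  define \<beta> where "\<beta> = (\<lambda>(f, y)\<in>points (F \<times>\<^sub>C DB). (base f, y \<otimes>\<^bsub>ZR_group r s\<^esub> L f))"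
  have points_FB: "points (F \<times>\<^sub>C DB) = points F \<times> carrier (ZR_group r s)"
    by (simp add: DB_def topspace_ZR_topology)
  have \<beta>: "\<beta> x = (base (fst x), snd x \<otimes>\<^bsub>ZR_group r s\<^esub> L (fst x))" if "x \<in> points (F \<times>\<^sub>C DB)" for x
    using that by (simp add: \<beta>_def case_prod_unfold)
  have \<beta>_points: "\<beta> x \<in> points (F \<times>\<^sub>C DB)" if "x \<in> points (F \<times>\<^sub>C DB)" for x
    using that base_points[of "fst x"] L[of "fst x"] unfolding \<beta>[OF that] points_FB
    by (simp add: F_def mem_Times_iff)
  have "translation i (F \<times>\<^sub>C DB) \<beta>"
    unfolding translation_def
  proof (intro conjI allI ballI)
    show "\<beta> \<in> points (F \<times>\<^sub>C DB) \<rightarrow>\<^sub>E points (F \<times>\<^sub>C DB)"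
      using \<beta>_points by (auto simp: PiE_iff \<beta>_def)
    fix N c F' assume c: "c \<in> cubes (F \<times>\<^sub>C DB) N" and F': "F' \<in> dcube_faces N i"
    define c' where "c' = (\<lambda>v\<in>dcube N. if v \<in> F' then \<beta> (c v) else c v)"
    have cP: "c v \<in> points (F \<times>\<^sub>C DB)" if "v \<in> dcube N" for v
      using c that by (auto simp: cubes_prod_cubespace_iff dest: PiE_mem)
    then have fstP: "fst (c v) \<in> points F" if "v \<in> dcube N" for v
      using that by (auto simp: points_FB mem_Times_iff)
    have c'P: "c' v \<in> points (F \<times>\<^sub>C DB)" if "v \<in> dcube N" for v
      using cP[OF that] \<beta>_points that by (simp add: c'_def)
    have cF: "(\<lambda>v\<in>dcube N. fst (c v)) \<in> cubes F N" and cB: "(\<lambda>v\<in>dcube N. snd (c v)) \<in> cubes DB N"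
      using c by (auto simp: cubes_prod_cubespace_iff)
    have "c' \<in> cubes (F \<times>\<^sub>C DB) N"
      unfolding cubes_prod_cubespace_iff
    proof (intro conjI)
      show "c' \<in> dcube N \<rightarrow>\<^sub>E points F \<times> points DB"
        using c'P by (auto simp: c'_def)
      have "(\<lambda>v\<in>dcube N. fst (c' v)) = (\<lambda>v\<in>dcube N. if v \<in> F' then base ((\<lambda>v\<in>dcube N. fst (c v)) v)
          else (\<lambda>v\<in>dcube N. fst (c v)) v)"
        by (rule restrict_ext) (simp add: c'_def \<beta>[OF cP])
      then show "(\<lambda>v\<in>dcube N. fst (c' v)) \<in> cubes F N"
        using base_translation[OF cF[unfolded F_def] F'] by (simp add: F_def)
      show "(\<lambda>v\<in>dcube N. snd (c' v)) \<in> cubes DB N"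
        unfolding DB_def B.cubes_Dnil_iff
      proof (intro conjI ballI)
        show "(\<lambda>v\<in>dcube N. snd (c' v)) \<in> dcube N \<rightarrow>\<^sub>E carrier (ZR_group r s)"
          using c'P unfolding points_FB by (simp add: mem_Times_iff)
        fix j assume j: "j \<in> ZR_index r s"
        have "deg_le {0} k N (\<lambda>v. ZR_coord j ((\<lambda>v\<in>dcube N. snd (c v)) v))"
          using cB j unfolding DB_def B.cubes_Dnil_iff by blast
        \<comment> \<open>Cutting this function of degree \<open>k - i\<close> off to a face of
          codimension \<open>i\<close> yields degree \<open>k\<close>, just what a cube
          allows.\<close>
        moreover have "deg_le {0} (k - i) N (\<lambda>v. m j * W j ((\<lambda>v\<in>dcube N. fst (c v)) v))"
          using degW[OF j] cF unfolding scalar_morphism_def by (intro deg_le_cmult) blast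
        from deg_le_face[OF add_subgroup_zero this F']
        have "deg_le {0} k N (\<lambda>v. if v \<in> F' then m j * W j ((\<lambda>v\<in>dcube N. fst (c v)) v) else 0)"
          using i by simp
        ultimately show "deg_le {0} k N (\<lambda>v. ZR_coord j ((\<lambda>v\<in>dcube N. snd (c' v)) v))"
        proof (rule deg_le_eqI[OF deg_le_add[OF add_subgroup_zero]])
          fix v assume v: "v \<in> dcube N"
          show "ZR_coord j ((\<lambda>v\<in>dcube N. snd (c' v)) v) = ZR_coord j ((\<lambda>v\<in>dcube N. snd (c v)) v) +
              (if v \<in> F' then m j * W j ((\<lambda>v\<in>dcube N. fst (c v)) v) else 0)"
            using v by (simp add: c'_def \<beta>[OF cP[OF v]] ZR_coord_mult[OF j] L_coord[OF j fstP[OF v]])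
        qed
      qed
    qed
    then show "(\<lambda>v\<in>dcube N. if v \<in> F' then \<beta> (c v) else c v) \<in> cubes (F \<times>\<^sub>C DB) N"
      by (simp add: c'_def)
  qed
  moreover have "continuous_map (ctop (F \<times>\<^sub>C DB)) (ctop (F \<times>\<^sub>C DB)) \<beta>"
  proof -
    have c_snd: "continuous_map (ctop (F \<times>\<^sub>C DB)) (ZR_topology r s) (\<lambda>x. snd x \<otimes>\<^bsub>ZR_group r s\<^esub> L (fst x))"
    proof (rule continuous_map_ZR_topologyI)
      fix x assume "x \<in> points (F \<times>\<^sub>C DB)"
      then show "snd x \<otimes>\<^bsub>ZR_group r s\<^esub> L (fst x) \<in> carrier (ZR_group r s)"
        using L unfolding points_FB by (simp add: mem_Times_iff)
    next
      fix j assume j: "j \<in> ZR_index r s"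
      have "continuous_map (ctop (F \<times>\<^sub>C DB)) euclideanreal (ZR_coord j \<circ> snd)"
        by (rule continuous_map_compose[OF _ ZR_coord_continuous[OF j]])
          (simp add: DB_def continuous_map_snd)
      moreover have "continuous_map (ctop (F \<times>\<^sub>C DB)) euclideanreal (W j \<circ> fst)"
        by (rule continuous_map_compose[OF _ cW[OF j]]) (simp add: continuous_map_fst)
      ultimately have "continuous_map (ctop (F \<times>\<^sub>C DB)) euclideanreal (\<lambda>x. ZR_coord j (snd x) + m j * W j (fst x))"
        by (auto intro!: continuous_intros simp: o_def)
      then show "continuous_map (ctop (F \<times>\<^sub>C DB)) euclideanreal (\<lambda>x. ZR_coord j (snd x \<otimes>\<^bsub>ZR_group r s\<^esub> L (fst x)))"
        by (rule continuous_map_eq) (simp only: points_FB mem_Times_iff ZR_coord_mult[OF j] L_coord[OF j])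
    qed
    have "continuous_map (ctop (F \<times>\<^sub>C DB)) (ctop F) (base \<circ> fst)"
      by (rule continuous_map_compose[OF _ c_base]) (simp add: continuous_map_fst)
    then have "continuous_map (ctop (F \<times>\<^sub>C DB)) (prod_topology (ctop F) (ZR_topology r s))
        (\<lambda>x. (base (fst x), snd x \<otimes>\<^bsub>ZR_group r s\<^esub> L (fst x)))"
      using c_snd by (intro continuous_map_pairedI) (simp_all add: o_def)
    then have "continuous_map (ctop (F \<times>\<^sub>C DB)) (ctop (F \<times>\<^sub>C DB))
        (\<lambda>x. (base (fst x), snd x \<otimes>\<^bsub>ZR_group r s\<^esub> L (fst x)))"
      by (simp add: DB_def)
    then show ?thesis
      by (rule continuous_map_eq) (rule \<beta>[symmetric])
  qed
  ultimately have "\<beta> \<in> \<Theta> i (F \<times>\<^sub>C DB)"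
    by (simp add: cont_translations_def)
  moreover have "\<alpha> (\<phi> x) = \<phi> (\<beta> x)" if x: "x \<in> points (F \<times>\<^sub>C DB)" for x
  proof -
    obtain f y where fy: "x = (f, y)" "f \<in> points F" "y \<in> carrier (ZR_group r s)"
      using x unfolding points_FB by blast
    have \<pi>_in: "\<pi> y \<in> carrier (ZT_group Z s)" for y
      unfolding \<pi>_def by (rule covering_hom_coord(1)[OF h _ g_def]) (rule n)
    have \<pi>_coord: "ZT_coord n g j (\<pi> y) - ZR_coord j y / m j \<in> \<int>" if "j \<in> ZR_index r s" for j y
      unfolding \<pi>_def m_def by (rule covering_hom_coord(2)[OF h _ g_def that]) (rule n)
    have f: "f \<in> points (free_nilspace k a b)" using fy by (simp add: F_def)
    have "\<alpha> (f, \<pi> y) = (base f, \<pi> (y \<otimes>\<^bsub>ZR_group r s\<^esub> L f))"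
    proof (rule prod_eqI)
      show "fst (\<alpha> (f, \<pi> y)) = fst (base f, \<pi> (y \<otimes>\<^bsub>ZR_group r s\<^esub> L f))"
        using \<alpha>_shift(1)[OF f \<pi>_in] by simp
      have "snd (\<alpha> (f, \<pi> y)) = \<pi> (y \<otimes>\<^bsub>ZR_group r s\<^esub> L f)"
      proof (rule A.char_eqI)
        show "snd (\<alpha> (f, \<pi> y)) \<in> carrier (ZT_group Z s)"
          using \<alpha>_points[OF f \<pi>_in, of y] by (simp add: mem_Times_iff)
        fix j assume j: "j \<in> ZR_index r s"
        let ?q = "\<pi> (y \<otimes>\<^bsub>ZR_group r s\<^esub> L f)"
        have 1: "ZT_coord n g j (snd (\<alpha> (f, \<pi> y))) - (ZT_coord n g j (displacement f) + ZT_coord n g j (\<pi> y)) \<in> \<int>"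
          by (rule \<alpha>_shift(2)[OF f \<pi>_in j])
        have 2: "ZT_coord n g j (\<pi> y) - ZR_coord j y / m j \<in> \<int>"
          by (rule \<pi>_coord[OF j])
        have 3: "ZT_coord n g j ?q - (ZR_coord j y / m j + W j f) \<in> \<int>"
          using \<pi>_coord[OF j, of "y \<otimes>\<^bsub>ZR_group r s\<^esub> L f"] m[OF j]
          by (simp add: ZR_coord_mult[OF j] L_coord[OF j fy(2)] add_divide_distrib)
        have 4: "W j f - ZT_coord n g j (displacement f) \<in> \<int>"
          by (rule W[OF j fy(2)])
        \<comment> \<open>\<open>1\<close> and \<open>2\<close> reduce the left side,
          \<open>3\<close> and \<open>4\<close> the right side, to the displacement of
          \<open>f\<close> and the coordinate of \<open>y\<close>.\<close>
        from Ints_diff[OF Ints_diff[OF Ints_add[OF 1 2] 3] 4]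
        show "ZT_coord n g j (snd (\<alpha> (f, \<pi> y))) - ZT_coord n g j ?q \<in> \<int>"
          by (simp add: algebra_simps)
      qed (rule \<pi>_in)
      then show "snd (\<alpha> (f, \<pi> y)) = snd (base f, \<pi> (y \<otimes>\<^bsub>ZR_group r s\<^esub> L f))" by simp
    qed
    then show ?thesis
      using \<beta>[OF x] by (simp add: fy(1) \<phi>_def)
  qed
  ultimately show ?thesis by blast
qed

end
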